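(* Let $K$ be a field of characteristic $0$, let $F=K[C_1,C_2]$, let $V$ be the variety of unitary algebras defined by the identities of $F$, and let $n\ge 4$. Among the polynomials $\varphi_2^{(n-1)}$, $\varphi_3^{(n-2)}$, $\varphi_{2,2}^{(n-3)}$ of degree $n+1$ (the generators of the irreducible components of $\Gamma_{n+1}(V)$), the consequences (modulo the identities of $V$) of the corresponding polynomials of degree $n$ are exactly the following. (1) The polynomials $\varphi_2^{(n-1)}$, $\varphi_{2,2}^{(n-3)}$ and $\varphi_3^{(n-2)}$ follow from $\varphi_2^{(n-2)}$. (2) The polynomials $\varphi_{2,2}^{(n-3)}$ and $\varphi_3^{(n-2)}$ follow from $\varphi_{2,2}^{(n-4)}$ (and $\varphi_2^{(n-1)}$ does not). (3) The polynomials $\varphi_{2,2}^{(n-3)}$ and $\varphi_3^{(n-2)}$ follow from $\varphi_3^{(n-3)}$ (and $\varphi_2^{(n-1)}$ does not).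
   Context: All algebras are unitary associative algebras over $K$. $K\langle T\rangle$ is the free unitary associative algebra on $T=\{t_1,t_2,\dots\}$; $T(F)$ is the T-ideal of identities of $F$. A polynomial $g$ follows from (is a consequence of) $f$ modulo the identities of $V$ if $g$ lies in the T-ideal generated by $f$ and $T(F)$. $\Gamma_m$ is the space of proper multilinear polynomials in $t_1,\dots,t_m$ (multilinear linear combinations of products of commutators of degree at least 2), and $\Gamma_m(V)=\Gamma_m/(\Gamma_m\cap T(F))$, an $S_m$-module. Commutators are left normed: $[a,b]=ab-ba$, $[a,b,c]=[[a,b],c]$, etc., and $[a,\dots,b^{(s)}]$ means that $b$ is repeated $s$ times at the end. The polynomials are $$\varphi_2^{(s)}(t_1,t_2)=2[t_1,t_2,t_1^{(s)}]\ (s\ge 0),\qquad \varphi_{2,2}^{(s)}(t_1,t_2)=4[t_1,t_2][t_1,t_2,t_1^{(s)}]\ (s\ge 0),$$ $$\varphi_3^{(s)}(t_1,t_2,t_3)=\sum_{\sigma\in S_3}(-1)^{\sigma}[t_{\sigma(1)},t_{\sigma(2)}][t_{\sigma(3)},t_1^{(s)}]=2\big([t_1,t_2][t_3,t_1^{(s)}]-[t_1,t_3][t_2,t_1^{(s)}]\big)\ (s\ge 1).$$ Their complete linearisations generate the irreducible $S_m$-submodules $M_2^{(m-2)}$, $M_{2,2}^{(m-4)}$, $M_3^{(m-3)}$ in the decomposition $\Gamma_m(V)=M_2^{(m-2)}\oplus M_3^{(m-3)}\oplus M_{2,2}^{(m-4)}$. The algebra $F$: let $K[X;Y]=K[x_1,x_2,x_1',x_2']\otimes_K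 E(y_1,y_2,y_1',y_2')$ be the free supercommutative algebra on even (commuting, central) variables $X=\{x_1,x_2,x_1',x_2'\}$ and odd (pairwise anticommuting, square zero) variables $Y=\{y_1,y_2,y_1',y_2'\}$, where $E(y_1,y_2,y_1',y_2')$ is the Grassmann algebra on the vector space with basis $Y$. Put $C_i=\begin{pmatrix}x_i&y_i\\ y_i'&x_i'\end{pmatrix}\in M_2(K[X;Y])$ for $i=1,2$. Then $F=K[C_1,C_2]$ is the unitary $K$-subalgebra of $M_2(K[X;Y])$ generated by $C_1$ and $C_2$. *)

theory Defs
  imports
    "HOL-Analysis.Cartesian_Space"
    "HOL-Library.Poly_Mapping"
    "HOL-Library.Numeral_Type"
    "HOL-Combinatorics.Permutations"
begin

section \<open>Commutators\<close>

definition commutator :: "'a::ring \<Rightarrow> 'a \<Rightarrow> 'a"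
  where "commutator a b = a * b - b * a"

text \<open>
  The left normed commutator \<open>[a, b, \<dots>, b]\<close> with \<open>s\<close> entries \<open>b\<close>; for \<open>s = 0\<close> it is \<open>a\<close>.
  Thus \<open>[a, b, c\<^sup>(\<^sup>s\<^sup>)]\<close> is \<open>iter_commutator (commutator a b) c s\<close>.
\<close>

definition iter_commutator :: "'a::ring \<Rightarrow> 'a \<Rightarrow> nat \<Rightarrow> 'a"
  where "iter_commutator a b s = ((\<lambda>u. commutator u b) ^^ s) a"


section \<open>The free unitary associative algebra\<close>

text \<open>The free monoid of words, written additively so that finitely supported functions on it
  carry the convolution product of \<open>Poly_Mapping\<close>.\<close>

datatype fword = Fword (letters: "nat list")

instantiation fword :: monoid_add
begin

definition zero_fword :: fword
  where "0 = Fword []"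

definition plus_fword :: "fword \<Rightarrow> fword \<Rightarrow> fword"
  where "u + v = Fword (letters u @ letters v)"

instance
  by standard (auto simp: zero_fword_def plus_fword_def)

end

type_synonym 'k free_algebra = "fword \<Rightarrow>\<^sub>0 'k"

text \<open>The structure map \<open>c \<mapsto> c \<cdot> 1\<close> of a monoid algebra, used both for the free algebra and
  for polynomial rings.\<close>

abbreviation const :: "'k::zero \<Rightarrow> ('m::zero \<Rightarrow>\<^sub>0 'k)"
  where "const c \<equiv> Poly_Mapping.single 0 c"

text \<open>The letters are numbered from 0, so \<open>t i\<close> is the variable $t_{i+1}$.\<close>

definition t :: "nat \<Rightarrow> ('k::ring_1) free_algebra"
  where "t i = Poly_Mapping.single (Fword [i]) 1"

definition alg_endomorphism :: "(('k::comm_ring_1) free_algebra \<Rightarrow> 'k free_algebra) \<Rightarrow> bool"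
  where "alg_endomorphism h \<longleftrightarrow>
    h 1 = 1 \<and>
    (\<forall>f g. h (f + g) = h f + h g) \<and>
    (\<forall>f g. h (f * g) = h f * h g) \<and>
    (\<forall>c f. h (const c * f) = const c * h f)"

text \<open>Closure under multiplication by scalars is the case \<open>p = const c\<close> of the ideal property.\<close>

definition T_ideal :: "('k::comm_ring_1) free_algebra set \<Rightarrow> bool"
  where "T_ideal I \<longleftrightarrow>
    0 \<in> I \<and>
    (\<forall>f\<in>I. \<forall>g\<in>I. f + g \<in> I) \<and>
    (\<forall>f\<in>I. \<forall>p. p * f \<in> I \<and> f * p \<in> I) \<and>
    (\<forall>f\<in>I. \<forall>h. alg_endomorphism h \<longrightarrow> h f \<in> I)"


section \<open>The Grassmann algebra over a commutative ring\<close>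

text \<open>
  An element is given by its coefficients with respect to the basis
  $y_S = y_{s_1} \cdots y_{s_m}$, where $S = \{s_1 < \dots < s_m\}$ runs over the sets of generators.
  For disjoint $A$ and $B$ one has $y_A y_B = (-1)^k y_{A \cup B}$ with $k$ the number of inversions
  between $A$ and $B$; otherwise the product is zero.
\<close>

datatype ('v, 'r) grassmann = Grassmann (coeff: "'v set \<Rightarrow> 'r")

definition inversions :: "'v::linorder set \<Rightarrow> 'v set \<Rightarrow> nat"
  where "inversions A B = card {(a, b). a \<in> A \<and> b \<in> B \<and> b < a}"

definition grassmann_const :: "'r::zero \<Rightarrow> ('v, 'r) grassmann"
  where "grassmann_const r = Grassmann (\<lambda>S. if S = {} then r else 0)"

definition grassmann_gen :: "'v \<Rightarrow> ('v, 'r::zero_neq_one) grassmann"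
  where "grassmann_gen v = Grassmann (\<lambda>S. if S = {v} then 1 else 0)"

lemma grassmann_eqI: "(\<And>S. coeff f S = coeff g S) \<Longrightarrow> f = g"
  by (rule grassmann.expand) (rule ext)

instantiation grassmann :: ("{finite, linorder}", comm_ring_1) ring_1
begin

definition zero_grassmann :: "('a, 'b) grassmann"
  where "0 = grassmann_const 0"

definition one_grassmann :: "('a, 'b) grassmann"
  where "1 = grassmann_const 1"

definition plus_grassmann :: "('a, 'b) grassmann \<Rightarrow> ('a, 'b) grassmann \<Rightarrow> ('a, 'b) grassmann"
  where "f + g = Grassmann (\<lambda>S. coeff f S + coeff g S)"

definition minus_grassmann :: "('a, 'b) grassmann \<Rightarrow> ('a, 'b) grassmann \<Rightarrow> ('a, 'b) grassmann"
  where "f - g = Grassmann (\<lambda>S. coeff f S - coeff g S)"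

definition uminus_grassmann :: "('a, 'b) grassmann \<Rightarrow> ('a, 'b) grassmann"
  where "- f = Grassmann (\<lambda>S. - coeff f S)"

definition times_grassmann :: "('a, 'b) grassmann \<Rightarrow> ('a, 'b) grassmann \<Rightarrow> ('a, 'b) grassmann"
  where "f * g = Grassmann (\<lambda>S. \<Sum>A\<in>Pow S. (-1) ^ inversions A (S - A) * coeff f A * coeff g (S - A))"

lemma inversions_empty [simp]: "inversions {} B = 0" "inversions A {} = 0"
  by (simp_all add: inversions_def)

lemma inversions_Un_left:
  fixes A B C :: "'v::{finite, linorder} set"
  assumes "A \<inter> B = {}"
  shows "inversions (A \<union> B) C = inversions A C + inversions B C"
proof -
  have eq: "{(a, c). a \<in> A \<union> B \<and> c \<in> C \<and> c < a} =
      {(a, c). a \<in> A \<and> c \<in> C \<and> c < a} \<union> {(a, c). a \<in> B \<and> c \<in> C \<and> c < a}"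
    by auto
  show ?thesis
    unfolding inversions_def eq by (rule card_Un_disjoint) (use assms in auto)
qed

lemma inversions_Un_right:
  fixes A B C :: "'v::{finite, linorder} set"
  assumes "B \<inter> C = {}"
  shows "inversions A (B \<union> C) = inversions A B + inversions A C"
proof -
  have eq: "{(a, c). a \<in> A \<and> c \<in> B \<union> C \<and> c < a} =
      {(a, c). a \<in> A \<and> c \<in> B \<and> c < a} \<union> {(a, c). a \<in> A \<and> c \<in> C \<and> c < a}"
    by auto
  show ?thesis
    unfolding inversions_def eq by (rule card_Un_disjoint) (use assms in auto)
qed

lemma grassmann_mult_assoc:
  fixes f g h :: "('a, 'b) grassmann"
  shows "f * g * h = f * (g * h)"
proof (rule grassmann_eqI)
  fix S :: "'a set"
  have "coeff (f * g * h) S =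
    (\<Sum>D\<in>Pow S. \<Sum>A\<in>Pow D. (-1) ^ (inversions D (S - D) + inversions A (D - A)) *
       (coeff f A * coeff g (D - A) * coeff h (S - D)))"
    by (simp add: times_grassmann_def sum_distrib_left sum_distrib_right power_add mult_ac)
  also have "\<dots> = (\<Sum>(D, A)\<in>(SIGMA D:Pow S. Pow D).
       (-1) ^ (inversions D (S - D) + inversions A (D - A)) *
       (coeff f A * coeff g (D - A) * coeff h (S - D)))"
    by (rule sum.Sigma) auto
  also have "\<dots> = (\<Sum>(A, B)\<in>(SIGMA A:Pow S. Pow (S - A)).
       (-1) ^ (inversions A (S - A) + inversions B (S - A - B)) *
       (coeff f A * coeff g B * coeff h (S - A - B)))"
  proof (rule sum.reindex_bij_witness
      [where i = "\<lambda>(A, B). (A \<union> B, A)" and j = "\<lambda>(D, A). (A, D - A)"], goal_cases)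
    case (5 x)
    then obtain D A where x: "x = (D, A)" and sub: "D \<subseteq> S" "A \<subseteq> D"
      by auto
    have D: "D = A \<union> (D - A)" and SA: "S - A = (D - A) \<union> (S - D)"
      and SD: "S - A - (D - A) = S - D"
      using sub by auto
    have "inversions D (S - D) = inversions A (S - D) + inversions (D - A) (S - D)"
      by (subst D, rule inversions_Un_left) auto
    moreover have "inversions A (S - A) = inversions A (D - A) + inversions A (S - D)"
      by (subst SA, rule inversions_Un_right) auto
    ultimately have "inversions A (S - A) + inversions (D - A) (S - D) =
        inversions D (S - D) + inversions A (D - A)"
      by simp
    then show ?case
      by (simp only: x prod.case SD)
  qed auto
  also have "\<dots> = (\<Sum>A\<in>Pow S. \<Sum>B\<in>Pow (S - A).
       (-1) ^ (inversions A (S - A) + inversions B (S - A - B)) *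
       (coeff f A * coeff g B * coeff h (S - A - B)))"
    by (rule sum.Sigma [symmetric]) auto
  also have "\<dots> = coeff (f * (g * h)) S"
    by (simp add: times_grassmann_def sum_distrib_left sum_distrib_right power_add mult_ac)
  finally show "coeff (f * g * h) S = coeff (f * (g * h)) S" .
qed

lemma grassmann_mult_1_left: "1 * f = f" for f :: "('a, 'b) grassmann"
proof (rule grassmann_eqI)
  fix S :: "'a set"
  have "coeff (1 * f) S = (\<Sum>A\<in>Pow S. if A = {} then coeff f S else 0)"
    unfolding times_grassmann_def one_grassmann_def grassmann_const_def grassmann.sel
    by (rule sum.cong) auto
  then show "coeff (1 * f) S = coeff f S"
    by simp
qed

lemma grassmann_mult_1_right: "f * 1 = f" for f :: "('a, 'b) grassmann"
proof (rule grassmann_eqI)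
  fix S :: "'a set"
  have "coeff (f * 1) S = (\<Sum>A\<in>Pow S. if A = S then coeff f S else 0)"
    unfolding times_grassmann_def one_grassmann_def grassmann_const_def grassmann.sel
    by (rule sum.cong) auto
  then show "coeff (f * 1) S = coeff f S"
    by simp
qed

instance
proof
  fix f g h :: "('a, 'b) grassmann"
  show "f + g + h = f + (g + h)" "f + g = g + f" "0 + f = f" "- f + f = 0" "f - g = f + - g"
    by (simp_all add: plus_grassmann_def minus_grassmann_def uminus_grassmann_def
        zero_grassmann_def grassmann_const_def ac_simps grassmann_eqI)
  show "f * g * h = f * (g * h)"
    by (rule grassmann_mult_assoc)
  show "1 * f = f" "f * 1 = f"
    by (rule grassmann_mult_1_left grassmann_mult_1_right)+
  show "(f + g) * h = f * h + g * h" "f * (g + h) = f * g + f * h"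
    by (simp_all add: times_grassmann_def plus_grassmann_def algebra_simps sum.distrib)
  show "(0 :: ('a, 'b) grassmann) \<noteq> 1"
    by (auto simp: zero_grassmann_def one_grassmann_def grassmann_const_def fun_eq_iff)
qed

end

lemma grassmann_gen_square: "grassmann_gen v * grassmann_gen v = (0 :: ('v::{finite, linorder}, 'r::comm_ring_1) grassmann)"
proof (rule grassmann_eqI)
  fix S :: "'v set"
  show "coeff (grassmann_gen v * grassmann_gen v :: ('v, 'r) grassmann) S =
      coeff (0 :: ('v, 'r) grassmann) S"
    unfolding times_grassmann_def zero_grassmann_def grassmann_const_def grassmann_gen_def
      grassmann.sel
    by (subst sum.neutral) auto
qed

lemma grassmann_const_central:
  "grassmann_const r * f = f * grassmann_const r"
  for f :: "('v::{finite, linorder}, 'r::comm_ring_1) grassmann"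
proof (rule grassmann_eqI)
  fix S :: "'v set"
  have "coeff (grassmann_const r * f) S = (\<Sum>A\<in>Pow S. if A = {} then r * coeff f S else 0)"
    unfolding times_grassmann_def grassmann_const_def grassmann.sel
    by (rule sum.cong) auto
  also have "\<dots> = (\<Sum>A\<in>Pow S. if A = S then r * coeff f S else 0)"
    by simp
  also have "\<dots> = coeff (f * grassmann_const r) S"
    unfolding times_grassmann_def grassmann_const_def grassmann.sel
    by (rule sum.cong) auto
  finally show "coeff (grassmann_const r * f) S = coeff (f * grassmann_const r) S" .
qed

lemma grassmann_gen_anticommute:
  fixes v w :: "'v::{finite, linorder}"
  shows "grassmann_gen v * grassmann_gen w =
    - (grassmann_gen w * grassmann_gen v :: ('v, 'r::comm_ring_1) grassmann)"
proof (cases "v = w")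
  case True
  then show ?thesis by (simp add: grassmann_gen_square)
next
  case False
  have prod: "coeff (grassmann_gen a * grassmann_gen b :: ('v, 'r) grassmann) S =
      (if S = {a, b} then (if b < a then -1 else 1) else 0)" if "a \<noteq> b" for a b :: 'v and S
  proof -
    have inv: "{(x, y). x \<in> {a} \<and> y \<in> {b} \<and> y < x} = (if b < a then {(a, b)} else {})"
      by auto
    have "coeff (grassmann_gen a * grassmann_gen b :: ('v, 'r) grassmann) S =
       (\<Sum>A\<in>Pow S. if A = {a} then (if S = {a, b} then (-1) ^ inversions {a} {b} else 0) else 0)"
      unfolding times_grassmann_def grassmann_gen_def grassmann.sel
    proof (rule sum.cong)
      fix A assume "A \<in> Pow S"
      then have "S - A = {b} \<longleftrightarrow> S = {a, b}" if "A = {a}"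
        using that \<open>a \<noteq> b\<close> by blast
      moreover have "{a, b} - {a} = {b}"
        using \<open>a \<noteq> b\<close> by blast
      ultimately show "(-1) ^ inversions A (S - A) * (if A = {a} then 1 else 0) *
            (if S - A = {b} then 1 else (0 :: 'r)) =
          (if A = {a} then (if S = {a, b} then (-1) ^ inversions {a} {b} else 0) else 0)"
        by (cases "A = {a}"; cases "S = {a, b}") simp_all
    qed simp
    also have "\<dots> = (if S = {a, b} then (-1) ^ inversions {a} {b} else 0)"
      by (simp add: sum.delta)
    finally show ?thesis
      unfolding inversions_def inv by simp
  qed
  show ?thesis
  proof (rule grassmann_eqI)
    fix S :: "'v set"
    have "{w, v} = {v, w}"
      by blast
    then show "coeff (grassmann_gen v * grassmann_gen w :: ('v, 'r) grassmann) S =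
        coeff (- (grassmann_gen w * grassmann_gen v) :: ('v, 'r) grassmann) S"
      using False by (auto simp add: uminus_grassmann_def prod[OF False] prod[OF False[symmetric]])
  qed
qed


section \<open>The algebra generated by two generic supermatrices\<close>

text \<open>
  The indices \<open>0, 1, 2, 3 :: 4\<close> stand for $x_1, x_2, x_1', x_2'$ (even variables) and for
  $y_1, y_2, y_1', y_2'$ (odd variables).
\<close>

type_synonym 'k supercomm = "(4, (4 \<Rightarrow>\<^sub>0 nat) \<Rightarrow>\<^sub>0 'k) grassmann"

definition even_var :: "4 \<Rightarrow> ('k::field_char_0) supercomm"
  where "even_var i = grassmann_const (Poly_Mapping.single (Poly_Mapping.single i 1) 1)"

definition odd_var :: "4 \<Rightarrow> ('k::field_char_0) supercomm"
  where "odd_var i = grassmann_gen i"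

type_synonym 'k supermatrix = "'k supercomm ^ 2 ^ 2"

definition mat_const :: "'k::field_char_0 \<Rightarrow> 'k supermatrix"
  where "mat_const c = mat (grassmann_const (const c))"

definition C1 :: "('k::field_char_0) supermatrix"
  where "C1 = vector [vector [even_var 0, odd_var 0], vector [odd_var 2, even_var 2]]"

definition C2 :: "('k::field_char_0) supermatrix"
  where "C2 = vector [vector [even_var 1, odd_var 1], vector [odd_var 3, even_var 3]]"

definition unital_subalgebra :: "('k::field_char_0) supermatrix set \<Rightarrow> bool"
  where "unital_subalgebra A \<longleftrightarrow>
    mat 1 \<in> A \<and>
    (\<forall>a\<in>A. \<forall>b\<in>A. a + b \<in> A \<and> a ** b \<in> A) \<and>
    (\<forall>c. \<forall>a\<in>A. mat_const c ** a \<in> A)"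

definition F :: "('k::field_char_0) supermatrix set"
  where "F = unital_subalgebra hull {C1, C2}"


section \<open>Identities and consequences\<close>

text \<open>The value of a polynomial under the substitution sending the letter \<open>i\<close> to \<open>a i\<close>.\<close>

definition mat_eval :: "(nat \<Rightarrow> 'k supermatrix) \<Rightarrow> ('k::field_char_0) free_algebra \<Rightarrow> 'k supermatrix"
  where "mat_eval a f =
    (\<Sum>w\<in>Poly_Mapping.keys f.
      mat_const (Poly_Mapping.lookup f w) ** foldr (\<lambda>i M. a i ** M) (letters w) (mat 1))"

definition identities_F :: "('k::field_char_0) free_algebra set"
  where "identities_F = {f. \<forall>a. (\<forall>i. a i \<in> F) \<longrightarrow> mat_eval a f = 0}"

text \<open>The identities of the variety generated by an algebra are those of the algebra itself.\<close>

definition follows_from :: "('k::field_char_0) free_algebra \<Rightarrow> 'k free_algebra \<Rightarrow> bool"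
    (infix \<open>follows'_from\<close> 50)
  where "g follows_from f \<longleftrightarrow> g \<in> T_ideal hull (insert f identities_F)"


section \<open>The generating polynomials\<close>

definition phi2 :: "nat \<Rightarrow> ('k::field_char_0) free_algebra"
  where "phi2 s = 2 * iter_commutator (commutator (t 0) (t 1)) (t 0) s"

definition phi22 :: "nat \<Rightarrow> ('k::field_char_0) free_algebra"
  where "phi22 s =
    4 * (commutator (t 0) (t 1) * iter_commutator (commutator (t 0) (t 1)) (t 0) s)"

definition phi3 :: "nat \<Rightarrow> ('k::field_char_0) free_algebra"
  where "phi3 s = (\<Sum>\<sigma> | \<sigma> permutes {0, 1, 2}.
    of_int (sign \<sigma>) *
      (commutator (t (\<sigma> 0)) (t (\<sigma> 1)) * iter_commutator (t (\<sigma> 2)) (t 0) s))"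

end

theory Submission
  imports Defs
begin

text \<open>
  Write \<open>D x = [x, a]\<close>. The only identity of \<open>F\<close> that the positive statements need is
  \<open>D (D b \<cdot> D c) = 0\<close>. It holds for all \<open>2 \<times> 2\<close> matrices over a supercommutative algebra with
  even diagonal and odd off-diagonal entries, and it lets one move \<open>D\<close> from one factor of
  \<open>D\<^sup>i b \<cdot> D\<^sup>j c\<close> to the other at the price of a sign (\<open>i, j > 0\<close>). Up to scalars, \<open>phi2 s\<close> is
  \<open>D\<^sup>s\<^sup>+\<^sup>1 b\<close>, \<open>phi22 s\<close> is \<open>D b \<cdot> D\<^sup>s\<^sup>+\<^sup>1 b\<close>, and \<open>phi3 s\<close> is \<open>D b \<cdot> D\<^sup>s c - D c \<cdot> D\<^sup>s b\<close>. The consequences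
  come from the substitutions \<open>b \<mapsto> b a\<close> and \<open>b \<mapsto> D b\<close> in (polarisations of) these expressions, and,
  for \<open>phi2\<close>, from the part of \<open>D\<^sup>s\<^sup>+\<^sup>1 b\<close> linear in \<open>d\<close> after \<open>a \<mapsto> a + d\<close>, \<open>d = a c\<close>.

  For the negative statements, commutators in \<open>F\<close> have all entries of order at least 1 in the odd
  variables, so \<open>phi22\<close> and \<open>phi3\<close> only take values of order at least 2; but \<open>phi2\<close> at
  \<open>C1, C2\<close> has a nonzero term linear in an odd variable.
\<close>

section \<open>Evaluation homomorphisms of the free algebra\<close>

lemma free_algebra_induct [case_names zero single add]:
  fixes f :: "'k::comm_ring_1 free_algebra"
  assumes "P 0" and "\<And>w c. P (Poly_Mapping.single w c)"
    and "\<And>f g. P f \<Longrightarrow> P g \<Longrightarrow> P (f + g)"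
  shows "P f"
proof (induction f rule: update_induct)
  case (const)
  then show ?case by (rule assms(1))
next
  case (update f w c)
  \<comment> \<open>\<open>w\<close> is not a key of \<open>f\<close>, so overwriting its
    coefficient amounts to adding a monomial.\<close>
  have "Poly_Mapping.update w c f = f + Poly_Mapping.single w c"
    using update.hyps
    by (intro poly_mapping_eqI) (auto simp add: lookup_update lookup_add lookup_single when_def in_keys_iff)
  then show ?case
    using assms(2,3) update.IH by simp
qed

text \<open>The operations of the target are parameters because the product \<open>**\<close> of matrices is not
  the multiplication of the type.\<close>

locale algebra_evaluation =
  fixes mul :: "'r::ab_group_add \<Rightarrow> 'r \<Rightarrow> 'r" (infixl \<open>\<odot>\<close> 70)
    and unit :: 'r
    and scalar :: "'k::comm_ring_1 \<Rightarrow> 'r"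
  assumes assoc: "x \<odot> (y \<odot> z) = x \<odot> y \<odot> z"
    and mul_add_right: "x \<odot> (y + z) = x \<odot> y + x \<odot> z"
    and mul_add_left: "(x + y) \<odot> z = x \<odot> z + y \<odot> z"
    and unit_left [simp]: "unit \<odot> x = x"
    and unit_right [simp]: "x \<odot> unit = x"
    and scalar_add: "scalar (c + d) = scalar c + scalar d"
    and scalar_mult: "scalar (c * d) = scalar c \<odot> scalar d"
    and scalar_1 [simp]: "scalar 1 = unit"
    and scalar_central: "scalar c \<odot> x = x \<odot> scalar c"
begin

definition word_value :: "(nat \<Rightarrow> 'r) \<Rightarrow> nat list \<Rightarrow> 'r"
  where "word_value a w = foldr (\<lambda>i M. a i \<odot> M) w unit"

definition evaluate :: "(nat \<Rightarrow> 'r) \<Rightarrow> 'k free_algebra \<Rightarrow> 'r"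
  where "evaluate a f =
    (\<Sum>w\<in>Poly_Mapping.keys f. scalar (Poly_Mapping.lookup f w) \<odot> word_value a (letters w))"

lemma mul_zero [simp]: "0 \<odot> x = 0" "x \<odot> 0 = 0"
  using mul_add_left[of 0 0 x] mul_add_right[of x 0 0] by simp_all

lemma scalar_0 [simp]: "scalar 0 = 0"
  using scalar_add[of 0 0] by simp

lemma word_value_append: "word_value a (u @ v) = word_value a u \<odot> word_value a v"
  by (induction u) (simp_all add: word_value_def assoc)

text \<open>Allows \<open>f\<close>, \<open>g\<close> and \<open>f + g\<close> to be summed over one
  common set of words.\<close>

lemma evaluate_superset:
  assumes "finite W" "Poly_Mapping.keys f \<subseteq> W"
  shows "evaluate a f = (\<Sum>w\<in>W. scalar (Poly_Mapping.lookup f w) \<odot> word_value a (letters w))"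
  unfolding evaluate_def using assms by (intro sum.mono_neutral_left) (auto simp: in_keys_iff)

lemma evaluate_0 [simp]: "evaluate a 0 = 0"
  by (simp add: evaluate_def)

lemma evaluate_single: "evaluate a (Poly_Mapping.single w c) = scalar c \<odot> word_value a (letters w)"
  by (subst evaluate_superset[of "{w}"]) auto

lemma evaluate_1 [simp]: "evaluate a 1 = unit"
  using evaluate_single[of a 0 1] unfolding single_one by (simp add: word_value_def zero_fword_def)

lemma evaluate_const: "evaluate a (const c) = scalar c"
  by (simp add: evaluate_single zero_fword_def word_value_def)

lemma evaluate_t [simp]: "evaluate a (t i) = a i"
  by (simp add: t_def evaluate_single word_value_def)

lemma evaluate_add: "evaluate a (f + g) = evaluate a f + evaluate a g"
proof -
  let ?W = "Poly_Mapping.keys f \<union> Poly_Mapping.keys g"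
  have "evaluate a h = (\<Sum>w\<in>?W. scalar (Poly_Mapping.lookup h w) \<odot> word_value a (letters w))"
    if "Poly_Mapping.keys h \<subseteq> ?W" for h
    using that by (intro evaluate_superset) auto
  from this[of f] this[of g] this[of "f + g"] Poly_Mapping.keys_add[of f g] show ?thesis
    by (simp add: lookup_add scalar_add mul_add_left sum.distrib)
qed

lemma evaluate_mult: "evaluate a (f * g) = evaluate a f \<odot> evaluate a g"
proof (induction f rule: free_algebra_induct)
  case (single u c)
  show ?case
  proof (induction g rule: free_algebra_induct)
    case (single v d)
    \<comment> \<open>On monomials multiplicativity comes down to moving \<open>scalar d\<close>
      past the value of the first word.\<close>
    have "scalar c \<odot> scalar d \<odot> (x \<odot> y) = scalar c \<odot> x \<odot> (scalar d \<odot> y)" for x y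
      by (metis assoc scalar_central)
    then show ?case
      by (simp add: mult_single evaluate_single plus_fword_def word_value_append scalar_mult)
  qed (simp_all add: evaluate_add mul_add_right distrib_left)
qed (simp_all add: evaluate_add mul_add_left distrib_right)

lemma evaluate_minus: "evaluate a (f - g) = evaluate a f - evaluate a g"
  using evaluate_add[of a "f - g" g] by simp

lemma evaluate_commutator:
  "evaluate a (commutator f g) = evaluate a f \<odot> evaluate a g - evaluate a g \<odot> evaluate a f"
  by (simp add: commutator_def evaluate_minus evaluate_mult)

lemma evaluate_mem:
  assumes "\<And>i. a i \<in> A" "unit \<in> A" "\<And>x y. x \<in> A \<Longrightarrow> y \<in> A \<Longrightarrow> x + y \<in> A"
    and "\<And>x y. x \<in> A \<Longrightarrow> y \<in> A \<Longrightarrow> x \<odot> y \<in> A" "\<And>c x. x \<in> A \<Longrightarrow> scalar c \<odot> x \<in> A"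
  shows "evaluate a f \<in> A"
proof (induction f rule: free_algebra_induct)
  case zero
  show ?case using assms(5)[OF assms(2), of 0] by simp
next
  case (single w c)
  have "word_value a u \<in> A" for u
    by (induction u) (auto simp: word_value_def assms)
  then show ?case by (simp add: evaluate_single assms)
qed (simp add: evaluate_add assms)

text \<open>Both sides are algebra maps in \<open>f\<close> that agree on letters. Hence a condition
  on all values over a set closed under evaluation is stable under endomorphisms.\<close>

lemma evaluate_endomorphism:
  assumes "alg_endomorphism h"
  shows "evaluate a (h f) = evaluate (\<lambda>i. evaluate a (h (t i))) f"
proof -
  have add: "h (f + g) = h f + h g" and mult: "h (f * g) = h f * h g" and one: "h 1 = 1"
    and smult: "h (const c * f) = const c * h f" for f g c
    using assms by (auto simp: alg_endomorphism_def)
  show ?thesis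
  proof (induction f rule: free_algebra_induct)
    case zero
    show ?case using add[of 0 0] by simp
  next
    case (single w c)
    have *: "evaluate a (h (Poly_Mapping.single (Fword u) 1)) =
        word_value (\<lambda>i. evaluate a (h (t i))) u" for u
    proof (induction u)
      case Nil
      have "Poly_Mapping.single (Fword []) 1 = (1 :: 'k free_algebra)"
        by (metis single_one zero_fword_def)
      then show ?case by (simp add: one word_value_def)
    next
      case (Cons i u)
      have "Poly_Mapping.single (Fword (i # u)) 1 = t i * Poly_Mapping.single (Fword u) (1 :: 'k)"
        by (simp add: t_def mult_single plus_fword_def)
      with Cons show ?case
        by (simp add: mult evaluate_mult word_value_def)
    qed
    have "Poly_Mapping.single w c = const c * Poly_Mapping.single (Fword (letters w)) 1"
      by (simp add: mult_single)
    then have "evaluate a (h (Poly_Mapping.single w c)) =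
        scalar c \<odot> word_value (\<lambda>i. evaluate a (h (t i))) (letters w)"
      by (simp only: smult evaluate_mult evaluate_const *)
    then show ?case
      by (simp only: evaluate_single)
  qed (simp add: add evaluate_add)
qed

end

text \<open>With the free algebra as its own target, evaluation gives the substitution endomorphisms
  under which T-ideals are closed.\<close>

interpretation substitution: algebra_evaluation
  "(*) :: 'k::comm_ring_1 free_algebra \<Rightarrow> _" 1 const
proof
  fix c :: 'k and x :: "'k free_algebra"
  show "const c * x = x * const c"
    by (induction x rule: free_algebra_induct)
      (simp_all add: mult_single mult.commute distrib_left distrib_right)
qed (simp_all add: mult.assoc distrib_left distrib_right single_add mult_single)

lemma alg_endomorphism_substitution: "alg_endomorphism (substitution.evaluate a)"
  by (simp add: alg_endomorphism_def substitution.evaluate_add substitution.evaluate_mult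
      substitution.evaluate_const)

lemma substitution_commutator [simp]:
  "substitution.evaluate a (commutator f g) =
    commutator (substitution.evaluate a f) (substitution.evaluate a g)"
  by (simp add: commutator_def substitution.evaluate_minus substitution.evaluate_mult)

lemma iter_commutator_Suc [simp]:
  "iter_commutator x a (Suc s) = commutator (iter_commutator x a s) a"
  by (simp add: iter_commutator_def)

lemma iter_commutator_0 [simp]: "iter_commutator x a 0 = x"
  by (simp add: iter_commutator_def)

lemma substitution_iter_commutator [simp]:
  "substitution.evaluate a (iter_commutator f g s) =
    iter_commutator (substitution.evaluate a f) (substitution.evaluate a g) s"
  by (induction s) simp_all

section \<open>Consequences of the generating polynomials\<close>

lemma commutator_add_left: "commutator (x + y) a = commutator x a + commutator y a"
  by (simp add: commutator_def algebra_simps)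

lemma commutator_diff_left: "commutator (x - y) a = commutator x a - commutator y a"
  by (simp add: commutator_def algebra_simps)

lemma commutator_sum_left: "commutator (sum f A) a = (\<Sum>x\<in>A. commutator (f x) a)"
  by (simp add: commutator_def sum_distrib_left sum_distrib_right sum_subtractf)

lemma commutator_mult_left: "commutator (x * y) a = commutator x a * y + x * commutator y a"
  by (simp add: commutator_def algebra_simps)

lemma commutator_swap: "commutator x y = - commutator y x"
  by (simp add: commutator_def)

lemma iter_commutator_commutator:
  "iter_commutator (commutator x a) a s = iter_commutator x a (Suc s)"
  by (induction s) simp_all

lemma iter_commutator_add:
  "iter_commutator (x + y) a s = iter_commutator x a s + iter_commutator y a s"
  by (induction s) (simp_all add: commutator_add_left)

lemma iter_commutator_minus: "iter_commutator (- x) a s = - iter_commutator x a s"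
  by (induction s) (simp_all add: commutator_def)

lemma iter_commutator_0_left: "iter_commutator 0 a s = 0"
  by (induction s) (simp_all add: commutator_def)

text \<open>Commuting with \<open>a\<close> is a derivation that kills \<open>a\<close>, so a right
  factor \<open>a\<close> passes through. This makes \<open>b * a\<close> a useful substitution for
  \<open>b\<close>.\<close>

lemma iter_commutator_mult_self: "iter_commutator (x * a) a s = iter_commutator x a s * a"
  by (induction s) (simp_all add: commutator_def algebra_simps)

lemma of_nat_left_commute: "y * (of_nat n * x) = of_nat n * (y * x)" for x y :: "'a::ring_1"
  by (metis mult.assoc mult_of_nat_commute)

lemma commutator_of_nat_left: "commutator (of_nat n * x) y = of_nat n * commutator x y"
  for x y :: "'a::ring_1"
  by (simp only: commutator_def right_diff_distrib mult.assoc of_nat_left_commute)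

lemma commutator_of_nat_right: "commutator x (of_nat n * y) = of_nat n * commutator x y"
  for x y :: "'a::ring_1"
  by (simp only: commutator_def right_diff_distrib mult.assoc of_nat_left_commute)

text \<open>The coefficient of \<open>l\<^sup>k\<close> in \<open>iter_commutator b (a + l d) m\<close>.\<close>

fun iter_commutator_coeff :: "'a::ring \<Rightarrow> 'a \<Rightarrow> 'a \<Rightarrow> nat \<Rightarrow> nat \<Rightarrow> 'a"
  where
    "iter_commutator_coeff b a d 0 k = (if k = 0 then b else 0)"
  | "iter_commutator_coeff b a d (Suc m) 0 = commutator (iter_commutator_coeff b a d m 0) a"
  | "iter_commutator_coeff b a d (Suc m) (Suc k) =
      commutator (iter_commutator_coeff b a d m (Suc k)) a + commutator (iter_commutator_coeff b a d m k) d"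

lemma iter_commutator_coeff_above: "m < k \<Longrightarrow> iter_commutator_coeff b a d m k = 0"
proof (induction m arbitrary: k)
  case (Suc m)
  then show ?case by (cases k) (simp_all add: commutator_def)
qed simp

lemma iter_commutator_coeff_0: "iter_commutator_coeff b a d m 0 = iter_commutator b a m"
  by (induction m) simp_all

text \<open>Natural numbers \<open>l\<close> suffice as parameters: they are central, and in
  characteristic 0 there are enough of them to separate the powers of \<open>l\<close>
  afterwards.\<close>

lemma iter_commutator_expand:
  fixes a b d :: "'a::ring_1"
  shows "iter_commutator b (a + of_nat l * d) m =
    (\<Sum>k\<le>m. of_nat l ^ k * iter_commutator_coeff b a d m k)"
proof (induction m)
  case (Suc m)
  let ?g = "iter_commutator_coeff b a d"
  have central: "commutator (of_nat l ^ k * x) y = of_nat l ^ k * commutator x y" for k x and y :: 'a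
    using commutator_of_nat_left[of "l ^ k"] by simp
  have split: "commutator x (a + y) = commutator x a + commutator x y" for x y
    by (simp add: commutator_def algebra_simps)
  have "iter_commutator b (a + of_nat l * d) (Suc m) =
      (\<Sum>k\<le>m. of_nat l ^ k * commutator (?g m k) a) +
      (\<Sum>k\<le>m. of_nat l ^ Suc k * commutator (?g m k) d)"
    using Suc by (simp add: split commutator_of_nat_right commutator_sum_left central sum_distrib_left mult.assoc)
  \<comment> \<open>The added term for \<open>Suc m\<close> is zero; it lets the index shift match
    the recursion for the coefficients.\<close>
  also have "(\<Sum>k\<le>m. of_nat l ^ k * commutator (?g m k) a) =
      (\<Sum>k\<le>Suc m. of_nat l ^ k * commutator (?g m k) a)"
    by (simp add: iter_commutator_coeff_above commutator_def)
  also have "\<dots> = commutator (?g m 0) a + (\<Sum>k\<le>m. of_nat l ^ Suc k * commutator (?g m (Suc k)) a)"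
    by (subst sum.atMost_Suc_shift) simp
  finally have "iter_commutator b (a + of_nat l * d) (Suc m) =
      commutator (?g m 0) a + (\<Sum>k\<le>m. of_nat l ^ Suc k * ?g (Suc m) (Suc k))"
    by (simp add: sum.distrib distrib_left add.assoc del: power_Suc)
  then show ?case
    by (subst sum.atMost_Suc_shift) simp
qed simp

section \<open>T-ideals and the separation of homogeneous components\<close>

locale free_T_ideal =
  fixes I :: "'k::field_char_0 free_algebra set"
  assumes T_ideal: "T_ideal I"
begin

lemma zero_mem [simp]: "0 \<in> I"
  and add_mem: "x \<in> I \<Longrightarrow> y \<in> I \<Longrightarrow> x + y \<in> I"
  and mult_left_mem: "x \<in> I \<Longrightarrow> p * x \<in> I"
  and mult_right_mem: "x \<in> I \<Longrightarrow> x * p \<in> I"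
  and endomorphism_mem: "x \<in> I \<Longrightarrow> alg_endomorphism h \<Longrightarrow> h x \<in> I"
  using T_ideal by (auto simp: T_ideal_def)

lemma minus_mem: "x \<in> I \<Longrightarrow> - x \<in> I"
  using mult_left_mem[of x "-1"] by simp

lemma minus_mem_iff: "- x \<in> I \<longleftrightarrow> x \<in> I"
  using minus_mem[of x] minus_mem[of "- x"] by auto

lemma diff_mem: "x \<in> I \<Longrightarrow> y \<in> I \<Longrightarrow> x - y \<in> I"
  using add_mem[of x "- y"] minus_mem[of y] by simp

lemma add_mem_iff: "x + y \<in> I \<Longrightarrow> x \<in> I \<longleftrightarrow> y \<in> I"
  using diff_mem[of "x + y" y] diff_mem[of "x + y" x] by auto

lemma commutator_mem: "x \<in> I \<Longrightarrow> commutator x a \<in> I"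
  by (simp add: commutator_def diff_mem mult_left_mem mult_right_mem)

lemma const_mult_mem_iff:
  assumes "c \<noteq> 0"
  shows "const c * x \<in> I \<longleftrightarrow> x \<in> I"
proof
  assume "const c * x \<in> I"
  then have "const (inverse c) * (const c * x) \<in> I" by (rule mult_left_mem)
  then show "x \<in> I" using assms by (simp add: mult_single flip: mult.assoc)
qed (rule mult_left_mem)

lemma numeral_mult_mem_iff: "numeral m * x \<in> I \<longleftrightarrow> x \<in> I"
  using const_mult_mem_iff[of "numeral m" x] by simp

lemma of_nat_mult_mem_iff: "m \<noteq> 0 \<Longrightarrow> of_nat m * x \<in> I \<longleftrightarrow> x \<in> I"
  using const_mult_mem_iff[of "of_nat m" x] by simp

text \<open>A Vandermonde argument by induction on \<open>N\<close>: with f(l) the given sum for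
  \<open>Suc N\<close>, \<open>2 ^ Suc N\<close> times f(l) minus f(2l) has no top component, and
  its other components are multiples of \<open>g k\<close> by nonzero integers, invertible in
  characteristic 0.\<close>

lemma homogeneous_parts_mem:
  assumes "\<And>l::nat. (\<Sum>k\<le>N. of_nat l ^ k * g k) \<in> I" and "k \<le> N"
  shows "g k \<in> I"
  using assms
proof (induction N arbitrary: g k)
  case 0
  from 0(1)[of 1] 0(2) show ?case by simp
next
  case (Suc N)
  have "(\<Sum>k\<le>N. of_nat l ^ k * ((2 ^ Suc N - 2 ^ k) * g k)) \<in> I" for l :: nat
  proof -
    have comm: "of_nat l ^ k * ((2 ^ j :: 'k free_algebra) * x) = 2 ^ j * (of_nat l ^ k * x)" for j k x
      using of_nat_left_commute[of "of_nat l ^ k" "2 ^ j"] by simp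
    have "2 ^ Suc N * (\<Sum>k\<le>Suc N. of_nat l ^ k * g k) -
        (\<Sum>k\<le>Suc N. of_nat (2 * l) ^ k * g k) \<in> I"
      by (intro diff_mem mult_left_mem Suc.prems(1))
    also have "2 ^ Suc N * (\<Sum>k\<le>Suc N. of_nat l ^ k * g k) -
        (\<Sum>k\<le>Suc N. of_nat (2 * l) ^ k * g k) =
        (\<Sum>k\<le>Suc N. of_nat l ^ k * ((2 ^ Suc N - 2 ^ k) * g k))"
      unfolding sum_distrib_left sum_subtractf[symmetric]
    proof (intro sum.cong refl)
      fix k
      have "of_nat (2 * l) ^ k = (2 ^ k * of_nat l ^ k :: 'k free_algebra)"
        using of_nat_power[of "2 * l" k, where 'a = "'k free_algebra"]
        by (simp only: power_mult_distrib of_nat_mult of_nat_power of_nat_numeral)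
      then have "of_nat (2 * l) ^ k * g k = 2 ^ k * (of_nat l ^ k * g k)"
        by (simp only: mult.assoc)
      then show "2 ^ Suc N * (of_nat l ^ k * g k) - of_nat (2 * l) ^ k * g k =
          of_nat l ^ k * ((2 ^ Suc N - 2 ^ k) * g k)"
        by (simp only: left_diff_distrib right_diff_distrib comm)
    qed
    finally show ?thesis by simp
  qed
  then have scaled: "(2 ^ Suc N - 2 ^ k) * g k \<in> I" if "k \<le> N" for k
    using that by (rule Suc.IH)
  have low: "g k \<in> I" if "k \<le> N" for k
  proof -
    have less: "(2::nat) ^ k < 2 ^ Suc N"
      using that by (intro power_strict_increasing) auto
    have "of_nat (2 ^ Suc N - 2 ^ k) * g k \<in> I"
      using scaled[OF that] by (simp only: of_nat_diff[OF less_imp_le[OF less]] of_nat_power of_nat_numeral)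
    moreover have "(2::nat) ^ Suc N - 2 ^ k \<noteq> 0"
      using less by linarith
    ultimately show ?thesis
      using of_nat_mult_mem_iff by blast
  qed
  have "sum g {..N} \<in> I"
  proof -
    have "sum g A \<in> I" if "A \<subseteq> {..N}" for A
      using finite_subset[OF that finite_atMost] that
      by (induction A rule: finite_induct) (auto intro: add_mem low)
    then show ?thesis by simp
  qed
  \<comment> \<open>At \<open>l = 1\<close> the hypothesis is the plain sum of all components, so
    the top one is left over.\<close>
  moreover have "sum g {..Suc N} \<in> I"
    using Suc.prems(1)[of 1] by simp
  ultimately have "g (Suc N) \<in> I"
    by (simp add: add_mem_iff)
  with low Suc.prems(2) show ?case
    by (cases "k = Suc N") auto
qed

end

section \<open>Consequences modulo the bracket identity\<close>

locale bracket_T_ideal = free_T_ideal +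
  assumes bracket_identity:
    "commutator (commutator (t 0) (t 1) * commutator (t 0) (t 2)) (t 0) \<in> I"
begin

text \<open>The two signs from reversing \<open>[a, b]\<close> and \<open>[a, c]\<close>
  cancel.\<close>

lemma bracket_mem:
  "commutator (commutator b a * commutator c a) a \<in> I"
proof -
  define \<sigma> where "\<sigma> i = (if i = 0 then a else if i = 1 then b else c)" for i :: nat
  from endomorphism_mem[OF bracket_identity alg_endomorphism_substitution[of \<sigma>]]
  show ?thesis
    by (simp add: \<sigma>_def substitution.evaluate_mult commutator_swap[of a])
qed

lemma iter_product_bracket_mem:
  "commutator (iter_commutator b a (Suc i) * iter_commutator c a (Suc j)) a \<in> I"
  using bracket_mem[of "iter_commutator b a i" a "iter_commutator c a j"] by simp

lemma shift_mem:
  "iter_commutator b a (Suc (Suc i)) * iter_commutator c a (Suc j) +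
   iter_commutator b a (Suc i) * iter_commutator c a (Suc (Suc j)) \<in> I"
  using iter_product_bracket_mem[of b a i c j] by (simp add: commutator_mult_left)

text \<open>By \<open>shift_mem\<close> each transfer of one \<open>D\<close> to the right factor
  costs only a sign, to which membership is blind; both exponents stay positive throughout.\<close>

lemma product_mem_iff:
  "iter_commutator b a (Suc i) * iter_commutator c a (Suc j) \<in> I \<longleftrightarrow>
   iter_commutator b a 1 * iter_commutator c a (Suc (i + j)) \<in> I"
proof (induction i arbitrary: j)
  case (Suc i)
  from Suc[of "Suc j"] add_mem_iff[OF shift_mem[of b a i c j]] show ?case by simp
qed simp

lemma phi22_from_phi22:
  assumes "\<And>a b. iter_commutator b a 1 * iter_commutator b a (Suc s) \<in> I"
  shows "iter_commutator b a 1 * iter_commutator b a (Suc (Suc s)) \<in> I"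
    and "iter_commutator b a 1 * iter_commutator c a (Suc (Suc s)) -
      iter_commutator c a 1 * iter_commutator b a (Suc (Suc s)) \<in> I"
proof -
  \<comment> \<open>Polarisation: the part bilinear in \<open>b\<close> and \<open>c\<close> of a
    form quadratic in \<open>b\<close>.\<close>
  have polar: "iter_commutator b a 1 * iter_commutator c a (Suc s) +
      iter_commutator c a 1 * iter_commutator b a (Suc s) \<in> I" for b c a
  proof -
    have "iter_commutator (b + c) a 1 * iter_commutator (b + c) a (Suc s) -
        iter_commutator b a 1 * iter_commutator b a (Suc s) -
        iter_commutator c a 1 * iter_commutator c a (Suc s) \<in> I"
      by (intro diff_mem assms)
    then show ?thesis
      by (simp only: iter_commutator_add) (simp add: algebra_simps del: iter_commutator_Suc)
  qed
  have "iter_commutator b a 1 * iter_commutator b a (Suc s) * a +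
      iter_commutator b a 1 * a * iter_commutator b a (Suc s) \<in> I"
    using polar[of b a "b * a"] by (simp only: iter_commutator_mult_self mult.assoc)
  then have "iter_commutator b a 1 * a * iter_commutator b a (Suc s) \<in> I"
    using add_mem_iff mult_right_mem[OF assms] by blast
  \<comment> \<open>The difference has the form
    \<open>x * y * a - x * a * y = x * commutator y a\<close>, which puts one more \<open>D\<close>
    on the second factor.\<close>
  from diff_mem[OF mult_right_mem[OF assms[of b a], of a] this]
  show "iter_commutator b a 1 * iter_commutator b a (Suc (Suc s)) \<in> I"
    by (simp add: commutator_def algebra_simps)
  \<comment> \<open>Polarise with \<open>D c\<close> in place of \<open>c\<close>; the shift then
    moves the extra \<open>D\<close> of the second product from \<open>c\<close> to \<open>b\<close>
    and turns the sum into a difference.\<close>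
  have "iter_commutator b a 1 * iter_commutator c a (Suc (Suc s)) +
      iter_commutator c a (Suc 1) * iter_commutator b a (Suc s) \<in> I"
    using polar[of b a "commutator c a"] by (simp only: iter_commutator_commutator)
  from diff_mem[OF this shift_mem[of c a 0 b s]]
  show "iter_commutator b a 1 * iter_commutator c a (Suc (Suc s)) -
      iter_commutator c a 1 * iter_commutator b a (Suc (Suc s)) \<in> I"
    by simp
qed

text \<open>For the first claim put \<open>c = D b\<close>: the shift makes the two products add up,
  leaving twice the wanted one. For the second, exchange \<open>b\<close> and \<open>c\<close>,
  replace \<open>b\<close> by \<open>b * a\<close>, and add the original relation multiplied by
  \<open>a\<close> on the right; what survives is one commutator with \<open>a\<close>.\<close>

lemma phi3_consequences:
  assumes "\<And>a b c. iter_commutator b a 1 * iter_commutator c a (Suc s) -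
      iter_commutator c a 1 * iter_commutator b a (Suc s) \<in> I"
  shows "iter_commutator b a 1 * iter_commutator b a (Suc (Suc s)) \<in> I"
    and "iter_commutator b a 1 * iter_commutator c a (Suc (Suc s)) \<in> I"
proof -
  have "iter_commutator b a 1 * iter_commutator b a (Suc (Suc s)) -
      iter_commutator b a (Suc 1) * iter_commutator b a (Suc s) \<in> I"
    using assms[of b a "commutator b a"] by (simp only: iter_commutator_commutator)
  from add_mem[OF this shift_mem[of b a 0 b s]]
  have "2 * (iter_commutator b a 1 * iter_commutator b a (Suc (Suc s))) \<in> I"
    by (simp add: mult_2)
  then show "iter_commutator b a 1 * iter_commutator b a (Suc (Suc s)) \<in> I"
    by (simp only: numeral_mult_mem_iff)
  have "iter_commutator c a 1 * iter_commutator b a (Suc s) * a -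
      iter_commutator b a 1 * a * iter_commutator c a (Suc s) \<in> I"
    using assms[of c a "b * a"] by (simp only: iter_commutator_mult_self mult.assoc)
  from add_mem[OF this mult_right_mem[OF assms[of b a c], of a]]
  show "iter_commutator b a 1 * iter_commutator c a (Suc (Suc s)) \<in> I"
    by (simp add: commutator_def algebra_simps)
qed

text \<open>The linear part in \<open>d\<close> of \<open>iter_commutator b (a + d) m\<close> at \<open>d = a * c\<close>: by the Leibniz rule
  for \<open>[x, a c] = [x, a] c + a [x, c]\<close>, all terms in which \<open>D\<close> hits a product \<open>D\<^sup>i b \<cdot> D\<^sup>j c\<close> with
  \<open>i, j > 0\<close> vanish modulo \<open>I\<close>.\<close>

lemma linear_part_mem:
  "iter_commutator_coeff b a (a * c) m 1 - a * iter_commutator_coeff b a c m 1 -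
   of_nat m * (iter_commutator b a m * c) -
   of_nat (m - 1) * (iter_commutator b a (m - 1) * commutator c a) \<in> I" (is "?R m \<in> I")
proof (induction m)
  case (Suc m)
  let ?D = "\<lambda>x. commutator x a"
  have prod: "commutator x (a * c) = ?D x * c + a * commutator x c" for x
    by (simp add: commutator_def algebra_simps)
  have [simp]: "?D a = 0" "?D (of_nat k) = 0" for k
    using mult_of_nat_commute[of k a] by (simp_all add: commutator_def)
  \<comment> \<open>\<open>D\<close> applied to
    \<open>of_nat m * (iter_commutator b a m * c)\<close> yields the terms for \<open>Suc m\<close>
    short of one \<open>D\<^sup>m\<^sup>+\<^sup>1 b * c\<close>, which \<open>prod\<close>
    supplies.\<close>
  have "?R (Suc m) = ?D (?R m) +
      of_nat (m - 1) * ?D (iter_commutator b a (m - 1) * commutator c a)"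
    by (simp add: iter_commutator_coeff_0 commutator_diff_left commutator_add_left prod
        distrib_left distrib_right commutator_mult_left)
  moreover have "of_nat (m - 1) * ?D (iter_commutator b a (m - 1) * commutator c a) \<in> I"
  \<comment> \<open>Truncated subtraction is harmless: for \<open>m \<le> 1\<close> the coefficient
    is 0, and otherwise both exponents are positive.\<close>
  proof (cases "m - 1")
    case (Suc i)
    then show ?thesis
      using iter_product_bracket_mem[of b a i c 0] by (intro mult_left_mem) simp
  qed simp
  ultimately show ?case
    by (simp only: add_mem commutator_mem Suc)
qed (simp add: commutator_def)

text \<open>The linear parts at \<open>d = a * c\<close> and at \<open>d = c\<close> both lie in
  \<open>I\<close>, so \<open>linear_part_mem\<close> leaves \<open>s\<close> times
  \<open>D\<^sup>s b * D c\<close>. Dividing by \<open>s\<close> and moving \<open>D\<close> to the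
  right gives the claim.\<close>

lemma phi2_consequences:
  assumes "\<And>a b. iter_commutator b a (Suc s) \<in> I" "s > 0"
  shows "iter_commutator b a 1 * iter_commutator c a s \<in> I"
proof -
  have lin: "iter_commutator_coeff b a d (Suc s) 1 \<in> I" for d
    by (rule homogeneous_parts_mem[where N = "Suc s"])
      (use assms(1)[of b "a + of_nat _ * d"] in \<open>simp_all only: iter_commutator_expand le_add2 plus_1_eq_Suc\<close>)
  have "of_nat s * (iter_commutator b a s * commutator c a) =
     iter_commutator_coeff b a (a * c) (Suc s) 1 - a * iter_commutator_coeff b a c (Suc s) 1 -
     of_nat (Suc s) * (iter_commutator b a (Suc s) * c) -
     (iter_commutator_coeff b a (a * c) (Suc s) 1 - a * iter_commutator_coeff b a c (Suc s) 1 -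
       of_nat (Suc s) * (iter_commutator b a (Suc s) * c) -
       of_nat (Suc s - 1) * (iter_commutator b a (Suc s - 1) * commutator c a))"
    by (simp only: diff_Suc_1) simp
  also have "\<dots> \<in> I"
    by (intro diff_mem mult_left_mem mult_right_mem lin assms(1) linear_part_mem)
  finally have "iter_commutator b a s * iter_commutator c a 1 \<in> I"
    using assms(2) by (simp add: of_nat_mult_mem_iff)
  then show ?thesis
    using product_mem_iff[of b a "s - 1" c 0] assms(2) by simp
qed

end

section \<open>The three generators as families of iterated commutators\<close>

context free_T_ideal
begin

lemma substitution_mem: "f \<in> I \<Longrightarrow> substitution.evaluate a f \<in> I"
  using endomorphism_mem alg_endomorphism_substitution by blast

text \<open>On letters \<open>phi2 s\<close> is -2 times \<open>D\<^sup>s\<^sup>+\<^sup>1 b\<close>,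
  and closure under substitution passes from letters to arbitrary \<open>a\<close> and
  \<open>b\<close>.\<close>

lemma phi2_mem_iff: "phi2 s \<in> I \<longleftrightarrow> (\<forall>a b. iter_commutator b a (Suc s) \<in> I)"
proof -
  have "(phi2 s :: 'k free_algebra) = 2 * - iter_commutator (t 1) (t 0) (Suc s)"
    by (simp only: phi2_def commutator_swap[of "t 0" "t 1"] iter_commutator_minus
        iter_commutator_commutator)
  then have "phi2 s \<in> I \<longleftrightarrow> iter_commutator (t 1) (t 0) (Suc s) \<in> I"
    by (metis numeral_mult_mem_iff minus_mem_iff)
  moreover have "iter_commutator b a (Suc s) \<in> I" if "iter_commutator (t 1) (t 0) (Suc s) \<in> I" for a b
    using substitution_mem[OF that, of "\<lambda>i. if i = 0 then a else b"] by simp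
  ultimately show ?thesis by blast
qed

lemma phi22_mem_iff:
  "phi22 s \<in> I \<longleftrightarrow> (\<forall>a b. iter_commutator b a 1 * iter_commutator b a (Suc s) \<in> I)"
proof -
  let ?f = "iter_commutator (t 1) (t 0) 1 * iter_commutator (t 1) (t 0) (Suc s) :: 'k free_algebra"
  have "phi22 s = 4 * ?f"
    unfolding phi22_def commutator_swap[of "t 0" "t 1"] iter_commutator_minus
      iter_commutator_commutator by simp
  then have "phi22 s \<in> I \<longleftrightarrow> ?f \<in> I"
    by (simp only: numeral_mult_mem_iff)
  moreover have "iter_commutator b a 1 * iter_commutator b a (Suc s) \<in> I" if "?f \<in> I" for a b
    using substitution_mem[OF that, of "\<lambda>i. if i = 0 then a else b"]
    by (simp add: substitution.evaluate_mult)
  ultimately show ?thesis by blast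
qed

text \<open>For \<open>s > 0\<close> the two permutations with \<open>\<sigma> 2 = 0\<close>
  contribute nothing, since their second factor starts with \<open>[t 0, t 0]\<close>; the other
  four agree in pairs.\<close>

lemma phi3_eq:
  fixes s :: nat
  assumes "s > 0"
  shows "(phi3 s :: 'k free_algebra) = 2 * (iter_commutator (t 2) (t 0) 1 * iter_commutator (t 1) (t 0) s -
    iter_commutator (t 1) (t 0) 1 * iter_commutator (t 2) (t 0) s)"
proof -
  have [simp]: "iter_commutator a a s = 0" for a :: "'k free_algebra"
  proof -
    obtain r where "s = Suc r" using assms by (cases s) auto
    then show ?thesis
      by (simp only: iter_commutator_commutator[symmetric]) (simp add: commutator_def iter_commutator_0_left)
  qed
  have fin: "finite {1, 2 :: nat}" "0 \<notin> {1, 2 :: nat}" "finite {2 :: nat}" "(1 :: nat) \<notin> {2}"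
    by auto
  show ?thesis
    unfolding phi3_def sum_over_permutations_insert[OF fin(1,2)]
      sum_over_permutations_insert[OF fin(3,4)] permutes_sing
    by (simp add: sign_compose sign_swap_id permutation_swap_id permutation_compose
        transpose_def commutator_swap[of "t 0"] commutator_swap[of "t (Suc 0)" "t 2"] algebra_simps mult_2)
qed

lemma phi3_mem_iff:
  assumes "s > 0"
  shows "phi3 s \<in> I \<longleftrightarrow> (\<forall>a b c. iter_commutator b a 1 * iter_commutator c a s -
    iter_commutator c a 1 * iter_commutator b a s \<in> I)"
proof -
  let ?f = "iter_commutator (t 2) (t 0) 1 * iter_commutator (t 1) (t 0) s -
    iter_commutator (t 1) (t 0) 1 * iter_commutator (t 2) (t 0) s :: 'k free_algebra"
  have "phi3 s \<in> I \<longleftrightarrow> ?f \<in> I"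
    by (simp only: phi3_eq[OF assms] numeral_mult_mem_iff)
  moreover have "iter_commutator b a 1 * iter_commutator c a s -
      iter_commutator c a 1 * iter_commutator b a s \<in> I" if "?f \<in> I" for a b c
    \<comment> \<open>\<open>t 2\<close> comes first in \<open>phi3_eq\<close>, hence letter 2 goes
      to \<open>b\<close> and letter 1 to \<open>c\<close>.\<close>
    using substitution_mem[OF that, of "\<lambda>i. if i = 0 then a else if i = 1 then c else b"]
    by (simp add: substitution.evaluate_mult substitution.evaluate_minus)
  ultimately show ?thesis
    by (intro iffI allI) simp_all
qed

end

section \<open>Supercommutativity and filtration of the Grassmann algebra\<close>

lemma grassmann_uminus_coeff [simp]: "coeff (- f) S = - coeff f S"
  by (simp add: uminus_grassmann_def)

lemma grassmann_add_coeff [simp]: "coeff (f + g) S = coeff f S + coeff g S"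
  by (simp add: plus_grassmann_def)

lemma grassmann_diff_coeff [simp]: "coeff (f - g) S = coeff f S - coeff g S"
  by (simp add: minus_grassmann_def)

lemma grassmann_0_coeff [simp]: "coeff 0 S = 0"
  by (simp add: zero_grassmann_def grassmann_const_def)

lemma grassmann_mult_coeff:
  "coeff (f * g) S = (\<Sum>A\<in>Pow S. (-1) ^ inversions A (S - A) * coeff f A * coeff g (S - A))"
  by (simp add: times_grassmann_def)

lemma grassmann_const_mult_coeff [simp]:
  fixes f :: "('v::{finite, linorder}, 'r::comm_ring_1) grassmann"
  shows "coeff (grassmann_const r * f) S = r * coeff f S"
proof -
  have "coeff (grassmann_const r * f) S = (\<Sum>A\<in>Pow S. if A = {} then r * coeff f S else 0)"
    unfolding times_grassmann_def grassmann_const_def grassmann.sel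
    by (rule sum.cong) auto
  then show ?thesis by simp
qed

lemma grassmann_mult_const_coeff [simp]:
  fixes f :: "('v::{finite, linorder}, 'r::comm_ring_1) grassmann"
  shows "coeff (f * grassmann_const r) S = r * coeff f S"
  by (simp flip: grassmann_const_central)

lemma grassmann_const_add: "grassmann_const (r + s) = grassmann_const r + grassmann_const s"
  for r s :: "'r::comm_ring_1"
  by (rule grassmann_eqI) (simp add: grassmann_const_def)

lemma grassmann_const_mult:
  "(grassmann_const (r * s) :: ('v::{finite, linorder}, 'r::comm_ring_1) grassmann) =
    grassmann_const r * grassmann_const s"
  by (rule grassmann_eqI) (simp, simp add: grassmann_const_def)

lemma grassmann_gen_mult_coeff:
  fixes f :: "('v::{finite, linorder}, 'r::comm_ring_1) grassmann"
  assumes "v \<notin> S"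
  shows "coeff (grassmann_gen v * f) S = 0" "coeff (f * grassmann_gen v) S = 0"
  unfolding grassmann_mult_coeff grassmann_gen_def grassmann.sel
  by (rule sum.neutral; use assms in auto)+

text \<open>Each pair from \<open>A\<close> and \<open>B\<close> is inverted in exactly one of the
  two orders. The parity of the product is the sign rule of supercommutativity.\<close>

lemma inversions_swap:
  fixes A B :: "'v::{finite, linorder} set"
  assumes "A \<inter> B = {}"
  shows "inversions A B + inversions B A = card A * card B"
proof -
  let ?X = "{(a, b). a \<in> A \<and> b \<in> B \<and> b < a}" and ?Y = "{(b, a). b \<in> B \<and> a \<in> A \<and> a < b}"
  have "inversions B A = card (prod.swap ` ?Y)"
    unfolding inversions_def by (rule card_image[symmetric]) simp
  then have "inversions A B + inversions B A = card (?X \<union> prod.swap ` ?Y)"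
    unfolding inversions_def by (subst card_Un_disjoint) auto
  also have "?X \<union> prod.swap ` ?Y = A \<times> B"
    using assms by (auto simp: image_iff)
  finally show ?thesis by (simp add: card_cartesian_product)
qed

lemma grassmann_mult_coeff_swap:
  fixes f g :: "('v::{finite, linorder}, 'r::comm_ring_1) grassmann"
  shows "coeff (g * f) S =
    (\<Sum>A\<in>Pow S. (-1) ^ inversions (S - A) A * coeff f A * coeff g (S - A))"
  unfolding grassmann_mult_coeff
  by (rule sum.reindex_bij_witness[where i = "\<lambda>A. S - A" and j = "\<lambda>A. S - A"])
    (auto simp: double_diff mult_ac)

section \<open>Parity of Grassmann elements\<close>

definition grassmann_even :: "('v, 'r::zero) grassmann \<Rightarrow> bool"
  where "grassmann_even f \<longleftrightarrow> (\<forall>S. coeff f S \<noteq> 0 \<longrightarrow> even (card S))"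

definition grassmann_odd :: "('v, 'r::zero) grassmann \<Rightarrow> bool"
  where "grassmann_odd f \<longleftrightarrow> (\<forall>S. coeff f S \<noteq> 0 \<longrightarrow> odd (card S))"

text \<open>The sign relating the two orders has exponent \<open>card A * card (S - A)\<close>,
  which is even whenever \<open>coeff f A\<close> is nonzero.\<close>

lemma grassmann_even_central:
  fixes f g :: "('v::{finite, linorder}, 'r::comm_ring_1) grassmann"
  assumes "grassmann_even f"
  shows "g * f = f * g"
proof (rule grassmann_eqI)
  fix S :: "'v set"
  have "(-1) ^ inversions (S - A) A * coeff f A = (-1) ^ inversions A (S - A) * coeff f A" for A
  proof (cases "coeff f A = 0")
    case False
    then have "even (inversions A (S - A) + inversions (S - A) A)"
      using assms by (subst inversions_swap) (auto simp: grassmann_even_def)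
    then show ?thesis by (auto simp: minus_one_power_iff)
  qed simp
  then show "coeff (g * f) S = coeff (f * g) S"
    unfolding grassmann_mult_coeff_swap[of g f] grassmann_mult_coeff[of f g] by simp
qed

lemma grassmann_odd_anticommute:
  fixes f g :: "('v::{finite, linorder}, 'r::comm_ring_1) grassmann"
  assumes "grassmann_odd f" "grassmann_odd g"
  shows "g * f = - (f * g)"
proof (rule grassmann_eqI)
  fix S :: "'v set"
  have "(-1) ^ inversions (S - A) A * coeff f A * coeff g (S - A) =
      - ((-1) ^ inversions A (S - A) * coeff f A * coeff g (S - A))" for A
  proof (cases "coeff f A = 0 \<or> coeff g (S - A) = 0")
    case False
    then have "odd (inversions A (S - A) + inversions (S - A) A)"
      using assms by (subst inversions_swap) (auto simp: grassmann_odd_def)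
    then show ?thesis by (auto simp: minus_one_power_iff)
  qed auto
  then show "coeff (g * f) S = coeff (- (f * g)) S"
    unfolding grassmann_uminus_coeff grassmann_mult_coeff_swap[of g f] grassmann_mult_coeff[of f g]
    by (simp add: sum_negf)
qed

text \<open>Anticommuting with itself gives twice the square equal to 0, and 2 cancels in a domain
  of characteristic 0.\<close>

lemma grassmann_odd_square:
  fixes f :: "('v::{finite, linorder}, 'r::{idom, ring_char_0}) grassmann"
  assumes "grassmann_odd f"
  shows "f * f = 0"
proof (rule grassmann_eqI)
  fix S :: "'v set"
  have "coeff (f * f) S = - coeff (f * f) S"
    by (subst grassmann_odd_anticommute[OF assms assms]) simp
  then have "2 * coeff (f * f) S = 0"
    by (simp only: eq_neg_iff_add_eq_0 mult_2)
  then show "coeff (f * f) S = coeff 0 S"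
    by simp
qed

lemma grassmann_parity_add:
  fixes f g :: "('v::{finite, linorder}, 'r::comm_ring_1) grassmann"
  shows "grassmann_even f \<Longrightarrow> grassmann_even g \<Longrightarrow> grassmann_even (f + g)"
    and "grassmann_odd f \<Longrightarrow> grassmann_odd g \<Longrightarrow> grassmann_odd (f + g)"
  by (force simp: grassmann_even_def grassmann_odd_def)+

lemma grassmann_even_diff: "grassmann_even f \<Longrightarrow> grassmann_even g \<Longrightarrow> grassmann_even (f - g)"
  for f g :: "('v::{finite, linorder}, 'r::comm_ring_1) grassmann"
  by (force simp: grassmann_even_def)

lemma grassmann_parity_mult:
  fixes f g :: "('v::{finite, linorder}, 'r::comm_ring_1) grassmann"
  shows "grassmann_even f \<Longrightarrow> grassmann_even g \<Longrightarrow> grassmann_even (f * g)"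
    and "grassmann_odd f \<Longrightarrow> grassmann_odd g \<Longrightarrow> grassmann_even (f * g)"
    and "grassmann_even f \<Longrightarrow> grassmann_odd g \<Longrightarrow> grassmann_odd (f * g)"
    and "grassmann_odd f \<Longrightarrow> grassmann_even g \<Longrightarrow> grassmann_odd (f * g)"
proof -
  have *: "\<exists>A B. coeff f A \<noteq> 0 \<and> coeff g B \<noteq> 0 \<and> card S = card A + card B"
    if nonzero: "coeff (f * g) S \<noteq> 0" for S
  proof -
    from nonzero obtain A where "A \<in> Pow S"
      and "(-1) ^ inversions A (S - A) * coeff f A * coeff g (S - A) \<noteq> 0"
      unfolding grassmann_mult_coeff by (rule sum.not_neutral_contains_not_neutral)
    then have A: "A \<subseteq> S" "coeff f A \<noteq> 0" "coeff g (S - A) \<noteq> 0"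
      by auto
    then have "card S = card A + card (S - A)"
      by (simp add: card_Diff_subset card_mono)
    with A show ?thesis by blast
  qed
  show "grassmann_even f \<Longrightarrow> grassmann_even g \<Longrightarrow> grassmann_even (f * g)"
    and "grassmann_odd f \<Longrightarrow> grassmann_odd g \<Longrightarrow> grassmann_even (f * g)"
    and "grassmann_even f \<Longrightarrow> grassmann_odd g \<Longrightarrow> grassmann_odd (f * g)"
    and "grassmann_odd f \<Longrightarrow> grassmann_even g \<Longrightarrow> grassmann_odd (f * g)"
    unfolding grassmann_even_def grassmann_odd_def by (fastforce dest!: *)+
qed

lemma grassmann_even_const: "grassmann_even (grassmann_const r)"
  by (simp add: grassmann_even_def grassmann_const_def)

lemma grassmann_odd_gen: "grassmann_odd (grassmann_gen v :: ('v, 'r::zero_neq_one) grassmann)"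
  by (auto simp: grassmann_odd_def grassmann_gen_def)

text \<open>The filtration by powers of the ideal generated by the odd generators.\<close>

definition grassmann_order_ge :: "nat \<Rightarrow> ('v, 'r::zero) grassmann \<Rightarrow> bool"
  where "grassmann_order_ge k f \<longleftrightarrow> (\<forall>S. card S < k \<longrightarrow> coeff f S = 0)"

lemma grassmann_order_ge_odd: "grassmann_odd f \<Longrightarrow> grassmann_order_ge 1 f"
  by (force simp: grassmann_order_ge_def grassmann_odd_def)

lemma grassmann_order_ge_add:
  fixes f g :: "('v::{finite, linorder}, 'r::comm_ring_1) grassmann"
  shows "grassmann_order_ge k f \<Longrightarrow> grassmann_order_ge k g \<Longrightarrow> grassmann_order_ge k (f + g)"
    and "grassmann_order_ge k f \<Longrightarrow> grassmann_order_ge k g \<Longrightarrow> grassmann_order_ge k (f - g)"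
  by (simp_all add: grassmann_order_ge_def)

lemma grassmann_order_ge_mult:
  fixes f g :: "('v::{finite, linorder}, 'r::comm_ring_1) grassmann"
  assumes "grassmann_order_ge k f" "grassmann_order_ge l g"
  shows "grassmann_order_ge (k + l) (f * g)"
  unfolding grassmann_order_ge_def grassmann_mult_coeff
proof (intro allI impI sum.neutral ballI)
  fix S A :: "'v set"
  assume "card S < k + l" "A \<in> Pow S"
  then have "card A < k \<or> card (S - A) < l"
    using card_Diff_subset[of A S] card_mono[of S A] by auto
  then show "(-1) ^ inversions A (S - A) * coeff f A * coeff g (S - A) = 0"
    using assms by (auto simp: grassmann_order_ge_def)
qed

section \<open>The generic supermatrices\<close>

lemma matrix_mult_entry: "(A ** B) $ i $ j = A $ i $ 1 * B $ 1 $ j + A $ i $ 2 * B $ 2 $ j"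
  for A B :: "'a::semiring_1 ^ 2 ^ 2"
  by (simp add: matrix_matrix_mult_def sum_2)

lemma matrix_eq_2: "A = B \<longleftrightarrow> A $ 1 $ 1 = B $ 1 $ 1 \<and> A $ 1 $ 2 = B $ 1 $ 2 \<and>
    A $ 2 $ 1 = B $ 2 $ 1 \<and> A $ 2 $ 2 = B $ 2 $ 2"
  for A B :: "'a ^ 2 ^ 2"
  by (simp add: vec_eq_iff forall_2)

lemma mat_entry: "mat k $ i $ j = (if i = j then k else 0)"
  by (simp add: mat_def)

interpretation matrix: algebra_evaluation
  "(**) :: 'k::field_char_0 supermatrix \<Rightarrow> _" "mat 1" mat_const
proof
  fix A :: "'k supermatrix" and c d :: 'k
  show "mat_const (c + d) = (mat_const c + mat_const d :: 'k supermatrix)"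
    by (simp add: matrix_eq_2 mat_const_def mat_entry single_add grassmann_const_add)
  show "mat_const (c * d) = (mat_const c ** mat_const d :: 'k supermatrix)"
    by (simp add: matrix_eq_2 matrix_mult_entry mat_const_def mat_entry
        flip: grassmann_const_mult) (simp add: mult_single)
  show "mat_const 1 = (mat 1 :: 'k supermatrix)"
    by (simp add: mat_const_def one_grassmann_def)
  show "mat_const c ** A = A ** mat_const c"
    by (simp add: matrix_eq_2 matrix_mult_entry mat_const_def mat_entry grassmann_const_central)
qed (simp_all add: matrix_mul_assoc matrix_add_ldistrib matrix_eq_2 matrix_mult_entry algebra_simps)

lemma mat_eval_eq: "mat_eval = matrix.evaluate"
  by (simp add: fun_eq_iff mat_eval_def matrix.evaluate_def matrix.word_value_def)

lemma unital_subalgebra_F: "unital_subalgebra F"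
  unfolding F_def hull_def unital_subalgebra_def by blast

lemma mat_eval_mem_F: "(\<And>i. a i \<in> F) \<Longrightarrow> mat_eval a f \<in> F"
  using unital_subalgebra_F unfolding mat_eval_eq unital_subalgebra_def
  by (intro matrix.evaluate_mem) auto

text \<open>The algebra usually called M_{1,1}, of which \<open>F\<close> is a subalgebra; the
  bracket identity is proved from this grading of the values alone.\<close>

definition supermatrix_graded :: "'k::field_char_0 supermatrix \<Rightarrow> bool"
  where "supermatrix_graded A \<longleftrightarrow> grassmann_even (A $ 1 $ 1) \<and> grassmann_odd (A $ 1 $ 2) \<and>
    grassmann_odd (A $ 2 $ 1) \<and> grassmann_even (A $ 2 $ 2)"

lemma grassmann_zero_parity [simp]: "grassmann_even 0" "grassmann_odd 0"
  by (simp_all add: grassmann_even_def grassmann_odd_def zero_grassmann_def grassmann_const_def)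

lemma supermatrix_graded_F:
  assumes "A \<in> F"
  shows "supermatrix_graded A"
proof -
  have const: "supermatrix_graded (mat (grassmann_const r))" for r
    by (simp add: supermatrix_graded_def mat_entry grassmann_even_const)
  have mult: "supermatrix_graded (A ** B)" if "supermatrix_graded A" "supermatrix_graded B"
    for A B :: "'a supermatrix"
    using that unfolding supermatrix_graded_def matrix_mult_entry
    by (auto intro: grassmann_parity_add grassmann_parity_mult)
  have add: "supermatrix_graded (A + B)" if "supermatrix_graded A" "supermatrix_graded B"
    for A B :: "'a supermatrix"
    using that by (auto simp: supermatrix_graded_def intro: grassmann_parity_add)
  have "unital_subalgebra {A :: 'a supermatrix. supermatrix_graded A}"
    by (simp add: unital_subalgebra_def one_grassmann_def mat_const_def const mult add)
  moreover have "{C1, C2} \<subseteq> {A. supermatrix_graded A}"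
    by (simp add: supermatrix_graded_def C1_def C2_def even_var_def odd_var_def
        grassmann_even_const grassmann_odd_gen)
  ultimately have "F \<subseteq> {A :: 'a supermatrix. supermatrix_graded A}"
    unfolding F_def by (intro hull_minimal)
  with assms show ?thesis by blast
qed

section \<open>Commutators of graded matrices and the bracket identity\<close>

definition mat_commutator :: "'k::field_char_0 supermatrix \<Rightarrow> 'k supermatrix \<Rightarrow> 'k supermatrix"
  where "mat_commutator A B = A ** B - B ** A"

lemma mat_eval_commutator:
  "mat_eval a (commutator f g) = mat_commutator (mat_eval a f) (mat_eval a g)"
  by (simp add: mat_eval_eq mat_commutator_def matrix.evaluate_commutator)

text \<open>Even entries are central and odd ones anticommute, so the two diagonal entries coincide,
  and the diagonals of \<open>A\<close> and \<open>B\<close> enter only through their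
  differences.\<close>

lemma mat_commutator_entries:
  assumes "supermatrix_graded A" "supermatrix_graded B"
  shows "mat_commutator A B $ 1 $ 1 = A $ 1 $ 2 * B $ 2 $ 1 + A $ 2 $ 1 * B $ 1 $ 2"
    and "mat_commutator A B $ 2 $ 2 = A $ 1 $ 2 * B $ 2 $ 1 + A $ 2 $ 1 * B $ 1 $ 2"
    and "mat_commutator A B $ 1 $ 2 =
      (A $ 1 $ 1 - A $ 2 $ 2) * B $ 1 $ 2 - (B $ 1 $ 1 - B $ 2 $ 2) * A $ 1 $ 2"
    and "mat_commutator A B $ 2 $ 1 =
      (B $ 1 $ 1 - B $ 2 $ 2) * A $ 2 $ 1 - (A $ 1 $ 1 - A $ 2 $ 2) * B $ 2 $ 1"
proof -
  have even: "x * A $ i $ i = A $ i $ i * x" "x * B $ i $ i = B $ i $ i * x" for x i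
    using assms exhaust_2[of i] by (auto simp: supermatrix_graded_def intro: grassmann_even_central)
  have odd: "B $ i $ j * A $ k $ l = - (A $ k $ l * B $ i $ j)" if "i \<noteq> j" "k \<noteq> l" for i j k l
    using assms that exhaust_2[of i] exhaust_2[of j] exhaust_2[of k] exhaust_2[of l]
    by (auto simp: supermatrix_graded_def intro!: grassmann_odd_anticommute)
  show "mat_commutator A B $ 1 $ 1 = A $ 1 $ 2 * B $ 2 $ 1 + A $ 2 $ 1 * B $ 1 $ 2"
    "mat_commutator A B $ 2 $ 2 = A $ 1 $ 2 * B $ 2 $ 1 + A $ 2 $ 1 * B $ 1 $ 2"
    by (simp_all add: mat_commutator_def matrix_mult_entry even(1)[of "B $ _ $ _"] odd)
  show "mat_commutator A B $ 1 $ 2 =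
      (A $ 1 $ 1 - A $ 2 $ 2) * B $ 1 $ 2 - (B $ 1 $ 1 - B $ 2 $ 2) * A $ 1 $ 2"
    "mat_commutator A B $ 2 $ 1 =
      (B $ 1 $ 1 - B $ 2 $ 2) * A $ 2 $ 1 - (A $ 1 $ 1 - A $ 2 $ 2) * B $ 2 $ 1"
    using even(1)[of "B $ 1 $ 2" 2] even(2)[of "A $ 1 $ 2" 2] even(1)[of "B $ 2 $ 1" 1]
      even(2)[of "A $ 2 $ 1" 1]
    by (simp_all add: mat_commutator_def matrix_mult_entry algebra_simps)
qed

text \<open>The three identities state the vanishing of the entries of \<open>[[A, A\<^sub>1] [A, A\<^sub>2], A]\<close>, where
  \<open>A\<close>, \<open>A\<^sub>1\<close>, \<open>A\<^sub>2\<close> have the off-diagonal entries \<open>b\<close>, \<open>c\<close> etc. and \<open>d\<close> etc. is the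
  difference of the diagonal entries.\<close>

lemma bracket_entries:
  fixes b c d :: "'a::ring_1"
  assumes central: "\<And>x. x * d = d * x" "\<And>x. x * d1 = d1 * x" "\<And>x. x * d2 = d2 * x"
    and square: "b * b = 0" "c * c = 0" "b1 * b1 = 0" "c1 * c1 = 0" "b2 * b2 = 0" "c2 * c2 = 0"
    and anti: "c * b = - (b * c)" "b1 * b = - (b * b1)" "c1 * b = - (b * c1)"
      "b2 * b = - (b * b2)" "c2 * b = - (b * c2)"
      "b1 * c = - (c * b1)" "c1 * c = - (c * c1)" "b2 * c = - (c * b2)" "c2 * c = - (c * c2)"
      "c1 * b1 = - (b1 * c1)" "b2 * b1 = - (b1 * b2)" "c2 * b1 = - (b1 * c2)"
      "b2 * c1 = - (c1 * b2)" "c2 * c1 = - (c1 * c2)" "c2 * b2 = - (b2 * c2)"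
    and p: "p1 = b * c1 + c * b1" "p2 = b * c2 + c * b2"
    and u: "u1 = d * b1 - d1 * b" "u2 = d * b2 - d2 * b"
    and v: "v1 = d1 * c - d * c1" "v2 = d2 * c - d * c2"
  shows "(p1 * u2 + u1 * p2) * c + (v1 * p2 + p1 * v2) * b = 0"
    and "(u1 * v2 - v1 * u2) * b = d * (p1 * u2 + u1 * p2)"
    and "d * (v1 * p2 + p1 * v2) = (u1 * v2 - v1 * u2) * c"
proof -
  have minus: "y * (x * z) = - (x * (y * z))" if "y * x = - (x * y)" for x y z :: 'a
    using that by (metis mult.assoc mult_minus_left)
  have central': "x * (d * y) = d * (x * y)" "x * (d1 * y) = d1 * (x * y)" "x * (d2 * y) = d2 * (x * y)"
    for x y by (metis central mult.assoc)+
  have square': "x * (x * z) = 0" if "x * x = 0" for x z :: 'a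
    using that by (metis mult.assoc mult_zero_left)
  note rules = square square[THEN square'] anti anti[THEN minus]
  \<comment> \<open>With \<open>rules\<close>, these bring each monomial to a normal form: first
    \<open>d\<close>, \<open>d1\<close>, \<open>d2\<close>, then the odd letters in the order
    \<open>b\<close>, \<open>c\<close>, \<open>b1\<close>, \<open>c1\<close>, \<open>b2\<close>,
    \<open>c2\<close> without repetition.\<close>
  have odd_central: "x * d = d * x" "x * d1 = d1 * x" "x * d2 = d2 * x"
      "x * (d * y) = d * (x * y)" "x * (d1 * y) = d1 * (x * y)" "x * (d2 * y) = d2 * (x * y)"
    if "x \<in> {b, c, b1, c1, b2, c2}" for x y
    by (rule central central')+
  note even_central = odd_central[of b, simplified] odd_central[of c, simplified]
    odd_central[of b1, simplified] odd_central[of c1, simplified]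
    odd_central[of b2, simplified] odd_central[of c2, simplified]
    central(1)[of d1] central(1)[of d2] central(2)[of d2]
    central'(1)[of d1] central'(1)[of d2] central'(2)[of d2]
  show "(p1 * u2 + u1 * p2) * c + (v1 * p2 + p1 * v2) * b = 0"
    "(u1 * v2 - v1 * u2) * b = d * (p1 * u2 + u1 * p2)"
    "d * (v1 * p2 + p1 * v2) = (u1 * v2 - v1 * u2) * c"
    unfolding p u v
    by (simp_all add: algebra_simps rules even_central)
qed

lemma bracket_identity_F:
  "(commutator (commutator (t 0) (t 1) * commutator (t 0) (t 2)) (t 0) :: 'k::field_char_0 free_algebra)
    \<in> identities_F"
  unfolding identities_F_def mem_Collect_eq
proof (intro allI impI)
  fix a :: "nat \<Rightarrow> 'k supermatrix"
  assume "\<forall>i. a i \<in> F"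
  then have graded: "supermatrix_graded (mat_eval a f)" for f
    by (simp add: mat_eval_mem_F supermatrix_graded_F)
  define A B C where "A = a 0" and "B = a 1" and "C = a 2"
  define N where "N = mat_commutator A B ** mat_commutator A C"
  have mat_eval_t: "mat_eval a (t i) = a i" for i
    by (simp add: mat_eval_eq)
  have N: "mat_eval a (commutator (t 0) (t 1) * commutator (t 0) (t 2)) = N"
    by (simp add: N_def A_def B_def C_def mat_eval_eq matrix.evaluate_mult
        matrix.evaluate_commutator mat_commutator_def)
  have gr: "supermatrix_graded A" "supermatrix_graded B" "supermatrix_graded C" "supermatrix_graded N"
    using graded[of "t 0"] graded[of "t 1"] graded[of "t 2"] graded N
    by (simp_all add: mat_eval_t A_def B_def C_def flip: N)
  have odd_entry: "grassmann_odd (A $ 1 $ 2)" "grassmann_odd (A $ 2 $ 1)"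
    "grassmann_odd (B $ 1 $ 2)" "grassmann_odd (B $ 2 $ 1)"
    "grassmann_odd (C $ 1 $ 2)" "grassmann_odd (C $ 2 $ 1)"
    using gr by (simp_all add: supermatrix_graded_def)
  have even_diff: "grassmann_even (A $ 1 $ 1 - A $ 2 $ 2)" "grassmann_even (B $ 1 $ 1 - B $ 2 $ 2)"
    "grassmann_even (C $ 1 $ 1 - C $ 2 $ 2)"
    using gr by (auto simp: supermatrix_graded_def intro: grassmann_even_diff)
  note entries = bracket_entries[where b = "A $ 1 $ 2" and c = "A $ 2 $ 1" and d = "A $ 1 $ 1 - A $ 2 $ 2"
      and ?b1.0 = "B $ 1 $ 2" and ?c1.0 = "B $ 2 $ 1" and ?d1.0 = "B $ 1 $ 1 - B $ 2 $ 2"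
      and ?b2.0 = "C $ 1 $ 2" and ?c2.0 = "C $ 2 $ 1" and ?d2.0 = "C $ 1 $ 1 - C $ 2 $ 2",
      OF even_diff[THEN grassmann_even_central] odd_entry[THEN grassmann_odd_square]
        grassmann_odd_anticommute[OF odd_entry(1) odd_entry(2)]
        grassmann_odd_anticommute[OF odd_entry(1) odd_entry(3)]
        grassmann_odd_anticommute[OF odd_entry(1) odd_entry(4)]
        grassmann_odd_anticommute[OF odd_entry(1) odd_entry(5)]
        grassmann_odd_anticommute[OF odd_entry(1) odd_entry(6)]
        grassmann_odd_anticommute[OF odd_entry(2) odd_entry(3)]
        grassmann_odd_anticommute[OF odd_entry(2) odd_entry(4)]
        grassmann_odd_anticommute[OF odd_entry(2) odd_entry(5)]
        grassmann_odd_anticommute[OF odd_entry(2) odd_entry(6)]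
        grassmann_odd_anticommute[OF odd_entry(3) odd_entry(4)]
        grassmann_odd_anticommute[OF odd_entry(3) odd_entry(5)]
        grassmann_odd_anticommute[OF odd_entry(3) odd_entry(6)]
        grassmann_odd_anticommute[OF odd_entry(4) odd_entry(5)]
        grassmann_odd_anticommute[OF odd_entry(4) odd_entry(6)]
        grassmann_odd_anticommute[OF odd_entry(5) odd_entry(6)]
        mat_commutator_entries(1)[OF gr(1,2)] mat_commutator_entries(1)[OF gr(1,3)]
        mat_commutator_entries(3)[OF gr(1,2)] mat_commutator_entries(3)[OF gr(1,3)]
        mat_commutator_entries(4)[OF gr(1,2)] mat_commutator_entries(4)[OF gr(1,3)]]
  \<comment> \<open>Equal diagonal entries of both commutators give the entries of \<open>N\<close>
    the shape met in \<open>bracket_entries\<close>.\<close>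
  have diag: "mat_commutator A B $ 2 $ 2 = mat_commutator A B $ 1 $ 1"
    "mat_commutator A C $ 2 $ 2 = mat_commutator A C $ 1 $ 1"
    using mat_commutator_entries(1,2)[OF gr(1,2)] mat_commutator_entries(1,2)[OF gr(1,3)] by simp_all
  have N_entries: "N $ 1 $ 2 = mat_commutator A B $ 1 $ 1 * mat_commutator A C $ 1 $ 2 +
        mat_commutator A B $ 1 $ 2 * mat_commutator A C $ 1 $ 1"
    "N $ 2 $ 1 = mat_commutator A B $ 2 $ 1 * mat_commutator A C $ 1 $ 1 +
        mat_commutator A B $ 1 $ 1 * mat_commutator A C $ 2 $ 1"
    "N $ 1 $ 1 - N $ 2 $ 2 = mat_commutator A B $ 1 $ 2 * mat_commutator A C $ 2 $ 1 -
        mat_commutator A B $ 2 $ 1 * mat_commutator A C $ 1 $ 2"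
    by (simp_all add: N_def matrix_mult_entry diag)
  \<comment> \<open>\<open>N\<close> is graded too: the first identity covers both diagonal entries,
    the other two the off-diagonal ones.\<close>
  have "mat_commutator N A = 0"
    unfolding matrix_eq_2 mat_commutator_entries[OF gr(4,1)] N_entries
    using entries by simp
  then show "mat_eval a (commutator (commutator (t 0) (t 1) * commutator (t 0) (t 2)) (t 0)) = 0"
    by (simp only: mat_eval_commutator N mat_eval_t A_def[symmetric])
qed

text \<open>An endomorphism merely changes which elements of \<open>F\<close> are substituted, so
  having all values in a two-sided ideal \<open>J\<close> is a T-closed condition. It serves for
  \<open>J\<close> the matrices of order at least 2.\<close>

lemma T_ideal_mat_eval:
  assumes "0 \<in> J" "\<And>A B. A \<in> J \<Longrightarrow> B \<in> J \<Longrightarrow> A + B \<in> J"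
    and "\<And>A B. A \<in> J \<Longrightarrow> B ** A \<in> J" "\<And>A B. A \<in> J \<Longrightarrow> A ** B \<in> J"
  shows "T_ideal {f. \<forall>a. (\<forall>i. a i \<in> F) \<longrightarrow> mat_eval a f \<in> J}"
proof -
  have "mat_eval a (h f) \<in> J"
    if f: "\<forall>a. (\<forall>i. a i \<in> F) \<longrightarrow> mat_eval a f \<in> J" and h: "alg_endomorphism h"
      and a: "\<forall>i. a i \<in> F" for a f h
  proof -
    have "mat_eval a (h f) = mat_eval (\<lambda>i. mat_eval a (h (t i))) f"
      unfolding mat_eval_eq by (rule matrix.evaluate_endomorphism[OF h])
    moreover have "mat_eval a (h (t i)) \<in> F" for i
      using a by (intro mat_eval_mem_F) auto
    ultimately show ?thesis using f by simp
  qed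
  moreover have "mat_eval a 0 = 0" "mat_eval a (f + g) = mat_eval a f + mat_eval a g"
    "mat_eval a (f * g) = mat_eval a f ** mat_eval a g" for a and f g :: "'a free_algebra"
    by (simp_all add: mat_eval_eq matrix.evaluate_add matrix.evaluate_mult)
  ultimately show ?thesis
    unfolding T_ideal_def mem_Collect_eq Ball_def using assms by simp
qed

section \<open>The T-ideal of polynomials with values of order at least 2\<close>

definition mat_order_ge :: "nat \<Rightarrow> 'k::field_char_0 supermatrix \<Rightarrow> bool"
  where "mat_order_ge k A \<longleftrightarrow> (\<forall>i j. grassmann_order_ge k (A $ i $ j))"

lemma mat_order_ge_add: "mat_order_ge k A \<Longrightarrow> mat_order_ge k B \<Longrightarrow> mat_order_ge k (A + B)"
  by (simp add: mat_order_ge_def grassmann_order_ge_add)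

lemma mat_order_ge_mult: "mat_order_ge k A \<Longrightarrow> mat_order_ge l B \<Longrightarrow> mat_order_ge (k + l) (A ** B)"
  by (simp add: mat_order_ge_def matrix_mult_entry grassmann_order_ge_add grassmann_order_ge_mult)

lemma mat_order_ge_0 [simp]: "mat_order_ge 0 A" "mat_order_ge k 0"
  by (simp_all add: mat_order_ge_def grassmann_order_ge_def zero_grassmann_def grassmann_const_def)

text \<open>Each term of the four entries contains an odd factor.\<close>

lemma mat_order_ge_commutator:
  assumes "supermatrix_graded A" "supermatrix_graded B"
  shows "mat_order_ge 1 (mat_commutator A B)"
proof -
  have odd: "grassmann_order_ge 1 (A $ 1 $ 2)" "grassmann_order_ge 1 (A $ 2 $ 1)"
    "grassmann_order_ge 1 (B $ 1 $ 2)" "grassmann_order_ge 1 (B $ 2 $ 1)"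
    using assms unfolding supermatrix_graded_def by (blast intro: grassmann_order_ge_odd)+
  have mult: "grassmann_order_ge 1 (f * g)" if "grassmann_order_ge 1 g"
    for f g :: "'a supercomm"
    using grassmann_order_ge_mult[of 0 f 1 g] that by (simp add: grassmann_order_ge_def)
  show ?thesis
    unfolding mat_order_ge_def forall_2 mat_commutator_entries[OF assms]
    by (intro conjI grassmann_order_ge_add mult odd)
qed

text \<open>The separating T-ideal: it contains the identities of \<open>F\<close>, every
  \<open>phi22\<close> and every \<open>phi3\<close> of positive index, but no
  \<open>phi2\<close>.\<close>

definition order_2_ideal :: "'k::field_char_0 free_algebra set"
  where "order_2_ideal = {f. \<forall>a. (\<forall>i. a i \<in> F) \<longrightarrow> mat_eval a f \<in> {A. mat_order_ge 2 A}}"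

lemma identities_F_subset_order_2_ideal: "identities_F \<subseteq> order_2_ideal"
  by (auto simp: identities_F_def order_2_ideal_def)

text \<open>Carries what is proved in \<open>bracket_T_ideal\<close> over to every T-ideal that
  enters the definition of a consequence.\<close>

lemma bracket_T_idealI: "T_ideal I \<Longrightarrow> identities_F \<subseteq> I \<Longrightarrow> bracket_T_ideal I"
  using bracket_identity_F by unfold_locales auto

interpretation order_2_ideal: bracket_T_ideal "order_2_ideal :: 'k::field_char_0 free_algebra set"
proof (rule bracket_T_idealI[OF _ identities_F_subset_order_2_ideal])
  have "mat_order_ge 2 (B ** A)" "mat_order_ge 2 (A ** B)" if "mat_order_ge 2 A"
    for A B :: "'k supermatrix"
    using mat_order_ge_mult[of 0 B 2 A] mat_order_ge_mult[of 2 A 0 B] that by (simp_all add: numeral_2_eq_2)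
  then show "T_ideal (order_2_ideal :: 'k free_algebra set)"
    unfolding order_2_ideal_def by (intro T_ideal_mat_eval) (auto intro: mat_order_ge_add)
qed

lemma commutator_product_order_2_ideal:
  "commutator f g * commutator p q \<in> order_2_ideal"
  unfolding order_2_ideal_def mem_Collect_eq
proof (intro allI impI)
  fix a :: "nat \<Rightarrow> 'a supermatrix"
  assume "\<forall>i. a i \<in> F"
  then have "mat_order_ge 1 (mat_eval a (commutator f g))" for f g
    unfolding mat_eval_commutator by (intro mat_order_ge_commutator supermatrix_graded_F mat_eval_mem_F) auto
  from mat_order_ge_mult[OF this this] show "mat_order_ge 2 (mat_eval a (commutator f g * commutator p q))"
    by (simp add: mat_eval_eq matrix.evaluate_mult numeral_2_eq_2)
qed

lemma phi22_order_2_ideal: "phi22 s \<in> order_2_ideal"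
  unfolding order_2_ideal.phi22_mem_iff by (simp add: commutator_product_order_2_ideal)

text \<open>The positive index makes the second factor of each product a commutator as well.\<close>

lemma phi3_order_2_ideal: "phi3 (Suc s) \<in> order_2_ideal"
  by (simp add: order_2_ideal.phi3_mem_iff commutator_product_order_2_ideal order_2_ideal.diff_mem)

lemma phi2_not_order_2_ideal: "phi2 s \<notin> order_2_ideal"
proof
  define a :: "nat \<Rightarrow> 'a supermatrix" where "a i = (if i = 0 then C1 else C2)" for i
  have F: "\<forall>i. a i \<in> F"
    by (simp add: a_def F_def hull_inc)
  let ?x = "\<lambda>i. Poly_Mapping.single (Poly_Mapping.single i 1) 1 :: (4 \<Rightarrow>\<^sub>0 nat) \<Rightarrow>\<^sub>0 'a"
  \<comment> \<open>Follow the coefficient of \<open>odd_var 1\<close> in the upper right entry: the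
    terms with \<open>odd_var 0\<close> from \<open>C1\<close> do not contribute to it, so each
    \<open>D\<close> multiplies it by x_1' - x_1.\<close>
  have coeff: "coeff (mat_eval a (iter_commutator (t 1) (t 0) m) $ 1 $ 2) {1} = (?x 2 - ?x 0) ^ m" for m
  proof (induction m)
    case 0
    show ?case
      by (simp add: mat_eval_eq a_def C2_def odd_var_def grassmann_gen_def)
  next
    case (Suc m)
    have "mat_eval a (t 0) = C1"
      by (simp add: mat_eval_eq a_def)
    with Suc show ?case
      by (simp add: mat_eval_commutator mat_commutator_def matrix_mult_entry C1_def even_var_def
          odd_var_def grassmann_gen_mult_coeff algebra_simps)
  qed
  assume "phi2 s \<in> (order_2_ideal :: 'a free_algebra set)"
  then have "iter_commutator (t 1) (t 0) (Suc s) \<in> (order_2_ideal :: 'a free_algebra set)"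
    unfolding order_2_ideal.phi2_mem_iff by blast
  then have "mat_order_ge 2 (mat_eval a (iter_commutator (t 1) (t 0) (Suc s)))"
    using F unfolding order_2_ideal_def by blast
  moreover have "card {1 :: 4} < 2"
    by simp
  ultimately have "(?x 2 - ?x 0) ^ Suc s = 0"
    unfolding coeff[symmetric] mat_order_ge_def grassmann_order_ge_def by blast
  \<comment> \<open>The polynomial ring is a domain, so a vanishing power would identify two
    distinct variables.\<close>
  then have "?x 2 = ?x 0"
    by auto
  from arg_cong[OF this, of Poly_Mapping.keys]
  have "Poly_Mapping.single (2 :: 4) (1 :: nat) = Poly_Mapping.single 0 1"
    by simp
  from arg_cong[OF this, of Poly_Mapping.keys] show False
    by simp
qed

section \<open>Consequences and the final statement\<close>

lemma follows_from_iff: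
  "g follows_from f \<longleftrightarrow> (\<forall>I. T_ideal I \<longrightarrow> identities_F \<subseteq> I \<longrightarrow> f \<in> I \<longrightarrow> g \<in> I)"
  by (auto simp: follows_from_def hull_def)

lemma follows_fromI:
  assumes "\<And>I. bracket_T_ideal I \<Longrightarrow> f \<in> I \<Longrightarrow> g \<in> I"
  shows "g follows_from f"
  using assms bracket_T_idealI by (auto simp: follows_from_iff)

lemma phi2_not_follows_from: "f \<in> order_2_ideal \<Longrightarrow> \<not> phi2 s follows_from f"
  using phi2_not_order_2_ideal order_2_ideal.T_ideal identities_F_subset_order_2_ideal
  unfolding follows_from_iff by blast

theorem proposition10:
  fixes n :: nat
  assumes "n \<ge> 4"
  shows
    "((phi2 (n - 1) :: ('k::field_char_0) free_algebra) follows_from phi2 (n - 2) \<and>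
      (phi22 (n - 3) :: 'k free_algebra) follows_from phi2 (n - 2) \<and>
      (phi3 (n - 2) :: 'k free_algebra) follows_from phi2 (n - 2)) \<and>
     ((phi22 (n - 3) :: 'k free_algebra) follows_from phi22 (n - 4) \<and>
      (phi3 (n - 2) :: 'k free_algebra) follows_from phi22 (n - 4) \<and>
      \<not> (phi2 (n - 1) :: 'k free_algebra) follows_from phi22 (n - 4)) \<and>
     ((phi22 (n - 3) :: 'k free_algebra) follows_from phi3 (n - 3) \<and>
      (phi3 (n - 2) :: 'k free_algebra) follows_from phi3 (n - 3) \<and>
      \<not> (phi2 (n - 1) :: 'k free_algebra) follows_from phi3 (n - 3))"
proof -
  \<comment> \<open>Removes truncated subtraction from the indices.\<close>
  obtain s where n: "n = s + 4"
    using assms by (metis add.commute le_Suc_ex)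
  have idx: "n - 1 = Suc (Suc (Suc s))" "n - 2 = Suc (Suc s)" "n - 3 = Suc s" "n - 4 = s"
    by (simp_all add: n)
  have "phi2 (Suc (Suc (Suc s))) \<in> I" "phi22 (Suc s) \<in> I" "phi3 (Suc (Suc s)) \<in> I"
    if "bracket_T_ideal I" "phi2 (Suc (Suc s)) \<in> I" for I :: "'k free_algebra set"
  proof -
    interpret bracket_T_ideal I by (rule that)
    have *: "iter_commutator b a (Suc (Suc (Suc s))) \<in> I" for a b
      using that(2) by (simp only: phi2_mem_iff)
    \<comment> \<open>All products \<open>D b * D\<^sup>s\<^sup>+\<^sup>2 c\<close> lie in
      \<open>I\<close>: the case \<open>c = b\<close> gives \<open>phi22\<close>, and differences
      give \<open>phi3\<close>.\<close>
    have **: "iter_commutator b a 1 * iter_commutator c a (Suc (Suc s)) \<in> I" for a b c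
      by (rule phi2_consequences[OF *]) simp
    show "phi2 (Suc (Suc (Suc s))) \<in> I"
      unfolding phi2_mem_iff using commutator_mem[OF *] by simp
    show "phi22 (Suc s) \<in> I"
      unfolding phi22_mem_iff using ** by blast
    show "phi3 (Suc (Suc s)) \<in> I"
      unfolding phi3_mem_iff[OF zero_less_Suc] using diff_mem[OF ** **] by blast
  qed
  moreover have "phi22 (Suc s) \<in> I" "phi3 (Suc (Suc s)) \<in> I"
    if "bracket_T_ideal I" "phi22 s \<in> I" for I :: "'k free_algebra set"
  proof -
    interpret bracket_T_ideal I by (rule that)
    have *: "iter_commutator b a 1 * iter_commutator b a (Suc s) \<in> I" for a b
      using that(2) by (simp only: phi22_mem_iff)
    show "phi22 (Suc s) \<in> I"
      unfolding phi22_mem_iff using phi22_from_phi22(1)[OF *] by blast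
    show "phi3 (Suc (Suc s)) \<in> I"
      unfolding phi3_mem_iff[OF zero_less_Suc] using phi22_from_phi22(2)[OF *] by blast
  qed
  moreover have "phi22 (Suc s) \<in> I" "phi3 (Suc (Suc s)) \<in> I"
    if "bracket_T_ideal I" "phi3 (Suc s) \<in> I" for I :: "'k free_algebra set"
  proof -
    interpret bracket_T_ideal I by (rule that)
    have *: "iter_commutator b a 1 * iter_commutator c a (Suc s) -
        iter_commutator c a 1 * iter_commutator b a (Suc s) \<in> I" for a b c
      using that(2) by (simp only: phi3_mem_iff[OF zero_less_Suc])
    show "phi22 (Suc s) \<in> I"
      unfolding phi22_mem_iff using phi3_consequences(1)[OF *] by blast
    show "phi3 (Suc (Suc s)) \<in> I"
      unfolding phi3_mem_iff[OF zero_less_Suc]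
      using diff_mem[OF phi3_consequences(2)[OF *] phi3_consequences(2)[OF *]] by blast
  qed
  ultimately show ?thesis
    unfolding idx
    by (intro conjI follows_fromI phi2_not_follows_from phi22_order_2_ideal phi3_order_2_ideal)
qed

end
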